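(* For all $k\in\mathbb{N}$ (positive integers), the number of dominant constraint graphs in $\mathcal{C}_{(\alpha_Z,2k)}$ is $$\left|\{C\in\mathcal{C}_{(\alpha_Z,2k)}: C\text{ is dominant}\}\right|=C'_k=\frac{1}{2k+1}\binom{3k}{k}.$$
   Context: The multigraph $H(\alpha_Z,2k)$: it has $4k$ vertices $a_{ij},b_{ij}$ with $i\in[k]$, $j\in\{1,2\}$. Its edges (a multiset) are, for each $i\in[k]$: $\{a_{ij},b_{ij}\}$ and $\{b_{ij},a_{(i+1)j}\}$ for $j=1,2$, together with $\{a_{i2},b_{i1}\}$ and $\{b_{i1},a_{(i+1)2}\}$. The first index is read cyclically, so $a_{(k+1)j}=a_{1j}$ (for $k=1$ every edge is doubled). This is the cyclic gluing of $k$ copies of the Z-shape $\alpha_Z$ (vertices $u_1,u_2,v_1,v_2$, edges $\{u_1,v_1\},\{u_2,v_1\},\{u_2,v_2\}$) and $k$ copies of its transpose. Its "pieces" are the vertex sets $\{a_{i1},a_{i2},b_{i1},b_{i2}\}$ and $\{b_{i1},b_{i2},a_{(i+1)1},a_{(i+1)2}\}$ for $i\in[k]$. A constraint graph $C$ on a vertex set $V$ is an acyclic graph on $V$; write $u\longleftrightarrow_C v$ if $u=v$ or $C$ contains a path from $u$ to $v$. Two constraint graphs are equivalent if they induce the same relation $\longleftrightarrow$; constraint graphs are considered (and counted) up to equivalence. $\mathcal{C}_{(\alpha_Z,2k)}$ is the set of (equivalence classes of) constraint graphs $C$ on the vertices of $H(\alpha_Z,2k)$ such that no two distinct vertices of the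 same piece satisfy $u\longleftrightarrow_C v$. $H/C$ is the multigraph obtained from $H$ by identifying vertices $u,v$ whenever $u\longleftrightarrow_C v$, keeping all edges with multiplicity. $\mathrm{val}(C)=1$ if every edge of $H(\alpha_Z,2k)/C$ has even multiplicity, and $\mathrm{val}(C)=0$ otherwise. $C\in\mathcal{C}_{(\alpha_Z,2k)}$ is dominant if $\mathrm{val}(C)\ne0$ and $|E(C)|$ is minimum among all $C'\in\mathcal{C}_{(\alpha_Z,2k)}$ with $\mathrm{val}(C')\neq 0$. *)

theory Defs
  imports Complex_Main "HOL-Library.Multiset"
begin

text \<open>
  \<open>VA i j\<close> and \<open>VB i j\<close> stand for \<open>a\<^sub>i\<^sub>j\<close> and \<open>b\<^sub>i\<^sub>j\<close>, with indices starting at 1.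
\<close>

datatype vertex = VA nat nat | VB nat nat

definition next_idx :: "nat \<Rightarrow> nat \<Rightarrow> nat" where
  "next_idx k i = (if i = k then 1 else i + 1)"

definition H_verts :: "nat \<Rightarrow> vertex set" where
  "H_verts k = {VA i j | i j. i \<in> {1..k} \<and> j \<in> {1, 2}} \<union> {VB i j | i j. i \<in> {1..k} \<and> j \<in> {1, 2}}"

text \<open>Edges of the multigraph are two-element vertex sets, collected in a multiset.\<close>

definition H_edges :: "nat \<Rightarrow> vertex set multiset" where
  "H_edges k = (\<Sum>i = 1..k.
     {# {VA i 1, VB i 1}, {VB i 1, VA (next_idx k i) 1},
        {VA i 2, VB i 2}, {VB i 2, VA (next_idx k i) 2},
        {VA i 2, VB i 1}, {VB i 1, VA (next_idx k i) 2} #})"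

definition pieces :: "nat \<Rightarrow> vertex set set" where
  "pieces k =
     {{VA i 1, VA i 2, VB i 1, VB i 2} | i. i \<in> {1..k}} \<union>
     {{VB i 1, VB i 2, VA (next_idx k i) 1, VA (next_idx k i) 2} | i. i \<in> {1..k}}"

text \<open>
  A simple graph on a fixed vertex set is given by its set of edges, each a two-element set.
  A path is its nonempty list of pairwise distinct vertices; a single vertex is a path,
  so \<open>linked C u u\<close> always holds.
\<close>

definition is_path :: "'a set set \<Rightarrow> 'a list \<Rightarrow> bool" where
  "is_path C p \<longleftrightarrow> p \<noteq> [] \<and> distinct p \<and> successively (\<lambda>x y. {x, y} \<in> C) p"

definition is_cycle :: "'a set set \<Rightarrow> 'a list \<Rightarrow> bool" where
  "is_cycle C p \<longleftrightarrow> is_path C p \<and> length p \<ge> 3 \<and> {last p, hd p} \<in> C"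

definition linked :: "'a set set \<Rightarrow> 'a \<Rightarrow> 'a \<Rightarrow> bool" where
  "linked C u v \<longleftrightarrow> (\<exists>p. is_path C p \<and> hd p = u \<and> last p = v)"

definition constraint_graphs :: "'a set \<Rightarrow> 'a set set set" where
  "constraint_graphs V =
     {C. (\<forall>e\<in>C. e \<subseteq> V \<and> card e = 2) \<and> (\<nexists>p. is_cycle C p)}"

definition constraint_equiv :: "'a set \<Rightarrow> ('a set set \<times> 'a set set) set" where
  "constraint_equiv V =
     {(C, C'). C \<in> constraint_graphs V \<and> C' \<in> constraint_graphs V \<and>
               (\<forall>u\<in>V. \<forall>v\<in>V. linked C u v \<longleftrightarrow> linked C' u v)}"

lemma equiv_constraint_equiv: "equiv (constraint_graphs V) (constraint_equiv V)"
  by (auto simp: constraint_equiv_def intro!: equivI refl_onI symI transI)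

text \<open>
  Representatives of the elements of \<open>\<C>\<^bsub>(\<alpha>\<^sub>Z,2k)\<^esub>\<close>; passing to equivalence classes is done by
  the quotient with respect to \<^const>\<open>constraint_equiv\<close>.
\<close>

definition admissible :: "nat \<Rightarrow> vertex set set set" where
  "admissible k = {C \<in> constraint_graphs (H_verts k).
     \<forall>P \<in> pieces k. \<forall>u\<in>P. \<forall>v\<in>P. u \<noteq> v \<longrightarrow> \<not> linked C u v}"

text \<open>
  The vertices of \<open>H/C\<close> are the classes of linked vertices; the edge \<open>{u, v}\<close> of \<open>H\<close> becomes the
  edge joining the classes of \<open>u\<close> and \<open>v\<close> (the singleton of a class would be a loop).
\<close>

definition vertex_class :: "nat \<Rightarrow> vertex set set \<Rightarrow> vertex \<Rightarrow> vertex set" where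
  "vertex_class k C u = {v \<in> H_verts k. linked C u v}"

definition quotient_edges :: "nat \<Rightarrow> vertex set set \<Rightarrow> vertex set set multiset" where
  "quotient_edges k C = image_mset (\<lambda>e. vertex_class k C ` e) (H_edges k)"

definition val :: "nat \<Rightarrow> vertex set set \<Rightarrow> nat" where
  "val k C = (if \<forall>e \<in># quotient_edges k C. even (count (quotient_edges k C) e) then 1 else 0)"

definition dominant :: "nat \<Rightarrow> vertex set set \<Rightarrow> bool" where
  "dominant k C \<longleftrightarrow> C \<in> admissible k \<and> val k C \<noteq> 0 \<and>
     (\<forall>C' \<in> admissible k. val k C' \<noteq> 0 \<longrightarrow> card C \<le> card C')"

definition dominant_classes :: "nat \<Rightarrow> vertex set set set set" where
  "dominant_classes k = {C \<in> admissible k. dominant k C} // constraint_equiv (H_verts k)"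

end

theory Submission
  imports Defs "HOL-Computational_Algebra.Formal_Power_Series"
begin

text \<open>
  Let row \<open>j\<close> of the multigraph be the closed walk
  \<open>a\<^sub>1\<^sub>j, b\<^sub>1\<^sub>j, a\<^sub>2\<^sub>j, b\<^sub>2\<^sub>j, \<dots>\<close> of length \<open>2k\<close>; besides the edges of the two rows there is one
  diagonal edge per step, which joins an \<open>a\<^sub>i\<^sub>2\<close> with a \<open>b\<^sub>i\<^sub>1\<close>. A constraint graph is a forest, so it
  has \<open>4k\<close> minus the number of its classes many edges, and up to equivalence it is just a partition
  of the vertices. Hence the partitions to be counted are those with as many classes as possible
  among the partitions that separate each piece and make all edge multiplicities even.

  \<^bold>\<open>The bound.\<close> Cut the cyclic strip at a layer and read it from there once around. In a fixed row, a step
  may enter a class that was not met before, or leave a class that is not met again, but not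
  both: the edge of that step would have multiplicity one. The classes outside the cut layer are all
  entered for a first time and left for a last time, and there are \<open>4k\<close> steps in the two rows, so
  there are at most \<open>2k + 2\<close> classes (\<open>card_classes_le\<close>).

  \<^bold>\<open>Rigidity.\<close> With \<open>2k + 2\<close> classes every step does exactly one of the two things, for every choice of the
  cut. Comparing two neighbouring cuts shows that if a class is next met at time \<open>T\<close>, then the class
  entered right after it is met for the last time at \<open>T - 1\<close> (\<open>next_visit_child\<close>). Together with evenness
  this keeps the rows disjoint (\<open>next_visit_same_row\<close>) and makes each row the depth-first
  traversal of a plane tree. So the \<open>a\<close>-vertices of row \<open>j\<close> form a noncrossing partition \<open>\<pi>\<^sub>j\<close>, the
  \<open>b\<close>-vertices its Kreweras complement (\<open>gap_class_iff\<close>), and evenness of the diagonals forces \<open>\<pi>\<^sub>1\<close> to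
  refine \<open>\<pi>\<^sub>2\<close> (\<open>first_row_refines_second\<close>). Conversely all pairs \<open>\<pi>\<^sub>1 \<le> \<pi>\<^sub>2\<close> arise, because each tree
  edge is traversed once in each direction and the walk formed by the diagonals is a quotient of
  the second row (\<open>interval_walk_even_edges\<close>).

  \<^bold>\<open>The count.\<close> An interval \<open>\<pi>\<^sub>1 \<le> \<pi>\<^sub>2\<close> of noncrossing partitions of \<open>n + 1\<close> points is cut into three intervals
  at the last points of the two blocks of the first point. The generating function therefore
  satisfies \<open>T = 1 + x T\<^sup>3\<close>, whose coefficients are \<open>1 / (2n + 1) (3n choose n)\<close>.
\<close>

section \<open>Counting intervals of noncrossing partitions\<close>

text \<open>
  A noncrossing partition of \<open>{p..<q}\<close> is encoded by the function that sends a point to the last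
  point of its block. Nestedness expresses that blocks do not cross and makes \<open>f\<close> idempotent.
  Taking \<open>f\<close> to be the identity outside the interval makes distinct partitions distinct functions and
  lets partitions of consecutive intervals be combined by composition.
\<close>

definition bracketing :: "nat \<Rightarrow> nat \<Rightarrow> (nat \<Rightarrow> nat) \<Rightarrow> bool" where
  "bracketing p q f \<longleftrightarrow>
     (\<forall>i. i \<le> f i) \<and> (\<forall>i j. i \<le> j \<longrightarrow> j \<le> f i \<longrightarrow> f j \<le> f i) \<and>
     (\<forall>i. i < p \<or> q \<le> i \<longrightarrow> f i = i) \<and> (\<forall>i<q. f i < q)"

text \<open>
  The equation \<open>g (f i) = g i\<close> says that points with the same \<open>f\<close>-block have the same \<open>g\<close>-block, so
  these are the pairs \<open>f \<le> g\<close> in the refinement order.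
\<close>

definition nc_intervals :: "nat \<Rightarrow> nat \<Rightarrow> ((nat \<Rightarrow> nat) \<times> (nat \<Rightarrow> nat)) set" where
  "nc_intervals p q = {(f, g). bracketing p q f \<and> bracketing p q g \<and> (\<forall>i. g (f i) = g i)}"

lemma bracketing_le: "bracketing p q f \<Longrightarrow> i \<le> f i"
  and bracketing_nested: "bracketing p q f \<Longrightarrow> i \<le> j \<Longrightarrow> j \<le> f i \<Longrightarrow> f j \<le> f i"
  and bracketing_outside: "bracketing p q f \<Longrightarrow> i < p \<or> q \<le> i \<Longrightarrow> f i = i"
  and bracketing_less: "bracketing p q f \<Longrightarrow> i < q \<Longrightarrow> f i < q"
  unfolding bracketing_def by blast+

lemma bracketing_idem:
  assumes "bracketing p q f"
  shows "f (f i) = f i"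
  using bracketing_nested[OF assms, of i "f i"] bracketing_le[OF assms, of "f i"]
    bracketing_le[OF assms, of i] by auto

lemma finite_bracketings: "finite {f. bracketing p q f}"
proof (rule inj_on_finite)
  show "inj_on (\<lambda>f. map f [0..<q]) {f. bracketing p q f}"
  proof (rule inj_onI, rule ext)
    fix f g i assume "f \<in> {f. bracketing p q f}" "g \<in> {f. bracketing p q f}"
      and eq: "map f [0..<q] = map g [0..<q]"
    then show "f i = g i"
      by (cases "i < q") (auto simp: bracketing_outside)
  qed
  show "(\<lambda>f. map f [0..<q]) ` {f. bracketing p q f} \<subseteq> {xs. set xs \<subseteq> {..<q} \<and> length xs = q}"
    by (auto simp: bracketing_less)
  show "finite {xs. set xs \<subseteq> {..<q} \<and> length xs = q}"
    by (rule finite_lists_length_eq) simp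
qed

lemma finite_nc_intervals: "finite (nc_intervals p q)"
  by (rule finite_subset[of _ "{f. bracketing p q f} \<times> {f. bracketing p q f}"])
    (auto simp: nc_intervals_def finite_bracketings)

definition shift_up :: "(nat \<Rightarrow> nat) \<Rightarrow> nat \<Rightarrow> nat" where
  "shift_up f i = (if i = 0 then 0 else Suc (f (i - 1)))"

definition shift_down :: "(nat \<Rightarrow> nat) \<Rightarrow> nat \<Rightarrow> nat" where
  "shift_down f i = f (Suc i) - 1"

lemma bracketing_shift_up: "bracketing p q f \<Longrightarrow> bracketing (Suc p) (Suc q) (shift_up f)"
  unfolding bracketing_def shift_up_def
  apply (intro conjI allI impI)
  subgoal for i by (cases i) auto
  subgoal for i j by (cases i; cases j) auto
  subgoal for i by (cases i) auto
  subgoal for i by (cases i) auto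
  done

lemma bracketing_shift_down:
  assumes "bracketing (Suc p) (Suc q) f" shows "bracketing p q (shift_down f)"
proof -
  have pos: "Suc i \<le> f (Suc i)" for i using bracketing_le[OF assms] .
  show ?thesis
    unfolding bracketing_def shift_down_def
    apply (intro conjI allI impI)
    subgoal for i using pos[of i] by simp
    subgoal for i j using bracketing_nested[OF assms, of "Suc i" "Suc j"] pos[of i] pos[of j]
      by linarith
    subgoal for i using bracketing_outside[OF assms, of "Suc i"] by auto
    subgoal for i using bracketing_less[OF assms, of "Suc i"] pos[of i] by auto
    done
qed

lemma card_nc_intervals_Suc:
  "card (nc_intervals (Suc p) (Suc q)) = card (nc_intervals p q)"
proof -
  let ?S = "nc_intervals p q" and ?S' = "nc_intervals (Suc p) (Suc q)"
  let ?up = "\<lambda>(f, g). (shift_up f, shift_up g)" and ?down = "\<lambda>(f, g). (shift_down f, shift_down g)"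
  have du: "shift_down (shift_up f) = f" for f
    by (auto simp: shift_down_def shift_up_def)
  have ud: "shift_up (shift_down f) = f" if f: "bracketing (Suc p) (Suc q) f" for f
  proof
    fix i show "shift_up (shift_down f) i = f i"
      using bracketing_le[OF f, of i] bracketing_outside[OF f, of 0]
      by (cases i) (auto simp: shift_down_def shift_up_def)
  qed
  have 1: "\<forall>a\<in>?S. ?down (?up a) = a" by (auto simp: du)
  have 2: "\<forall>a\<in>?S'. ?up (?down a) = a" by (auto simp: ud nc_intervals_def)
  have 3: "?up ` ?S \<subseteq> ?S'"
    by (auto simp: nc_intervals_def bracketing_shift_up) (auto simp: shift_up_def)
  have "?down (f, g) \<in> ?S" if "(f, g) \<in> ?S'" for f g
  proof -
    from that
    have f: "bracketing (Suc p) (Suc q) f" and g: "bracketing (Suc p) (Suc q) g"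
      and fg: "\<And>i. g (f i) = g i" by (auto simp: nc_intervals_def)
    have "shift_down g (shift_down f i) = shift_down g i" for i
      using fg[of "Suc i"] bracketing_le[OF f, of "Suc i"] by (simp add: shift_down_def)
    then show ?thesis
      by (simp add: nc_intervals_def bracketing_shift_down f g)
  qed
  then have 4: "?down ` ?S' \<subseteq> ?S" by (intro image_subsetI) auto
  show ?thesis
    using bij_betw_same_card[OF bij_betw_byWitness[OF 1 2 3 4]] by (rule sym)
qed

lemma card_nc_intervals: "card (nc_intervals p (p + n)) = card (nc_intervals 0 n)"
  by (induction p) (simp_all add: card_nc_intervals_Suc)

text \<open>
  The trace of a partition on \<open>{p..<q}\<close>: a block that continues beyond \<open>q\<close> is cut off by making
  \<open>q - 1\<close> its last point, which is right whenever \<open>q - 1\<close> belongs to that block.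
\<close>

definition restrict_block :: "nat \<Rightarrow> nat \<Rightarrow> (nat \<Rightarrow> nat) \<Rightarrow> nat \<Rightarrow> nat" where
  "restrict_block p q f i = (if p \<le> i \<and> i < q then min (f i) (q - 1) else i)"

lemma bracketing_restrict:
  assumes f: "bracketing p' q' f"
  shows "bracketing p q (restrict_block p q f)"
  unfolding bracketing_def restrict_block_def
  using bracketing_le[OF f] bracketing_nested[OF f]
  by (auto simp: min_def split: if_splits) (metis le_trans nat_le_linear)+

lemma nc_intervals_restrict:
  assumes fg: "(f, g) \<in> nc_intervals p' q'"
    and closed: "\<And>i. p \<le> i \<Longrightarrow> i < q \<Longrightarrow> f i < q"
  shows "(restrict_block p q f, restrict_block p q g) \<in> nc_intervals p q"
proof -
  have f: "bracketing p' q' f" and g: "bracketing p' q' g" and gf: "\<And>i. g (f i) = g i"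
    using fg by (auto simp: nc_intervals_def)
  have "restrict_block p q g (restrict_block p q f i) = restrict_block p q g i" for i
    using gf[of i] closed[of i] bracketing_le[OF f, of i]
    by (auto simp: restrict_block_def min_def)
  then show ?thesis using f g by (simp add: nc_intervals_def bracketing_restrict)
qed

text \<open>
  The finer partition on \<open>{0..n}\<close>, given its parts on \<open>{1..l}\<close>, \<open>{l+1..m}\<close> and \<open>{m+1..n}\<close>: the point
  \<open>0\<close> joins the block of \<open>l\<close>.
\<close>

definition glue_lower ::
  "nat \<Rightarrow> (nat \<Rightarrow> nat) \<Rightarrow> (nat \<Rightarrow> nat) \<Rightarrow> (nat \<Rightarrow> nat) \<Rightarrow> nat \<Rightarrow> nat" where
  "glue_lower l f1 f2 f3 i = (if i = 0 then l else f1 (f2 (f3 i)))"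

text \<open>
  In the coarser partition the points \<open>0\<close>, \<open>l\<close> and \<open>m\<close> share a block. So the block of \<open>l\<close> in the first
  part, whose points are those with \<open>g1 i = l\<close>, now ends at \<open>m\<close> instead of \<open>l\<close>.
\<close>

definition glue_upper ::
  "nat \<Rightarrow> nat \<Rightarrow> (nat \<Rightarrow> nat) \<Rightarrow> (nat \<Rightarrow> nat) \<Rightarrow> (nat \<Rightarrow> nat) \<Rightarrow> nat \<Rightarrow> nat" where
  "glue_upper l m g1 g2 g3 i =
     (if i = 0 \<or> i \<le> l \<and> g1 i = l then m else g1 (g2 (g3 i)))"

lemma glued_parts_apply:
  assumes lm: "l \<le> m" "m \<le> n"
    and f1: "bracketing 1 (Suc l) f1" and f2: "bracketing (Suc l) (Suc m) f2"
    and f3: "bracketing (Suc m) (Suc n) f3"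
  shows "f1 (f2 (f3 i)) = (if i \<le> l then f1 i else if i \<le> m then f2 i else f3 i)"
proof -
  consider "i \<le> l" | "l < i" "i \<le> m" | "m < i" by linarith
  then show ?thesis
  proof cases
    case 1
    then show ?thesis using lm bracketing_outside[OF f2, of i] bracketing_outside[OF f3, of i] by simp
  next
    case 2
    then show ?thesis
      using lm bracketing_outside[OF f3, of i] bracketing_le[OF f2, of i]
        bracketing_outside[OF f1, of "f2 i"] by simp
  next
    case 3
    then show ?thesis using lm bracketing_le[OF f3, of i]
        bracketing_outside[OF f2, of "f3 i"] bracketing_outside[OF f1, of "f3 i"] by simp
  qed
qed

lemma bracketing_glue_lower:
  assumes lm: "l \<le> m" "m \<le> n"
    and f1: "bracketing 1 (Suc l) f1" and f2: "bracketing (Suc l) (Suc m) f2"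
    and f3: "bracketing (Suc m) (Suc n) f3"
  shows "bracketing 0 (Suc n) (glue_lower l f1 f2 f3)"
proof -
  note tp = glued_parts_apply[OF lm f1 f2 f3]
  note le = bracketing_le[OF f1] bracketing_le[OF f2] bracketing_le[OF f3]
  have b1: "f1 i \<le> l" if "i \<le> l" for i using bracketing_less[OF f1, of i] that by simp
  have b2: "f2 i \<le> m" if "i \<le> m" for i using bracketing_less[OF f2, of i] that by simp
  have b3: "f3 i \<le> n" if "i \<le> n" for i using bracketing_less[OF f3, of i] that by simp
  show ?thesis
    unfolding bracketing_def glue_lower_def tp
  proof (intro conjI allI impI)
    fix i j
    assume ij: "i \<le> j" "j \<le> (if i = 0 then l else if i \<le> l then f1 i else if i \<le> m then f2 i else f3 i)"
    show "(if j = 0 then l else if j \<le> l then f1 j else if j \<le> m then f2 j else f3 j)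
          \<le> (if i = 0 then l else if i \<le> l then f1 i else if i \<le> m then f2 i else f3 i)"
      using ij b1[of i] b1[of j] b2[of i] b2[of j] b3[of i] lm le
        bracketing_nested[OF f1, of i j] bracketing_nested[OF f2, of i j] bracketing_nested[OF f3, of i j]
      by (auto split: if_splits)
  next
    fix i assume "i < 0 \<or> Suc n \<le> i"
    then show "(if i = 0 then l else if i \<le> l then f1 i else if i \<le> m then f2 i else f3 i) = i"
      using lm bracketing_outside[OF f3, of i] by auto
  next
    fix i assume "i < Suc n"
    then show "(if i = 0 then l else if i \<le> l then f1 i else if i \<le> m then f2 i else f3 i) < Suc n"
      using lm b1[of i] b2[of i] b3[of i] by auto
  qed (auto simp: le)
qed

lemma bracketing_glue_upper:
  assumes lm: "l \<le> m" "m \<le> n"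
    and g1: "bracketing 1 (Suc l) g1" and g2: "bracketing (Suc l) (Suc m) g2"
    and g3: "bracketing (Suc m) (Suc n) g3"
  shows "bracketing 0 (Suc n) (glue_upper l m g1 g2 g3)"
proof -
  note tp = glued_parts_apply[OF lm g1 g2 g3]
  note le = bracketing_le[OF g1] bracketing_le[OF g2] bracketing_le[OF g3]
  have b1: "g1 i \<le> l" if "i \<le> l" for i using bracketing_less[OF g1, of i] that by simp
  have b2: "g2 i \<le> m" if "i \<le> m" for i using bracketing_less[OF g2, of i] that by simp
  have b3: "g3 i \<le> n" if "i \<le> n" for i using bracketing_less[OF g3, of i] that by simp
  let ?g = "\<lambda>i. if i = 0 \<or> i \<le> l \<and> g1 i = l then m
     else if i \<le> l then g1 i else if i \<le> m then g2 i else g3 i"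
  show ?thesis
    unfolding bracketing_def glue_upper_def tp
  proof (intro conjI allI impI)
    fix i j
    assume ij: "i \<le> j" "j \<le> ?g i"
    have "l \<le> g1 l" using le(1) .
    then have "g1 l = l" using b1[of l] by simp
    then show "?g j \<le> ?g i"
      using ij b1[of i] b1[of j] b2[of i] b2[of j] b3[of i] lm le
        bracketing_nested[OF g1, of i j] bracketing_nested[OF g2, of i j] bracketing_nested[OF g3, of i j]
      by (auto split: if_splits)
  next
    fix i assume "i < 0 \<or> Suc n \<le> i"
    then show "?g i = i"
      using lm bracketing_outside[OF g3, of i] by auto
  next
    fix i assume "i < Suc n"
    then show "?g i < Suc n"
      using lm b1[of i] b2[of i] b3[of i] by auto
  qed (use le lm in \<open>auto intro: order_trans\<close>)
qed

lemma nc_intervals_glue: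
  assumes lm: "l \<le> m" "m \<le> n"
    and fg1: "(f1, g1) \<in> nc_intervals 1 (Suc l)" and fg2: "(f2, g2) \<in> nc_intervals (Suc l) (Suc m)"
    and fg3: "(f3, g3) \<in> nc_intervals (Suc m) (Suc n)"
  shows "(glue_lower l f1 f2 f3, glue_upper l m g1 g2 g3) \<in> nc_intervals 0 (Suc n)"
proof -
  have f: "bracketing 1 (Suc l) f1" "bracketing (Suc l) (Suc m) f2" "bracketing (Suc m) (Suc n) f3"
   and g: "bracketing 1 (Suc l) g1" "bracketing (Suc l) (Suc m) g2" "bracketing (Suc m) (Suc n) g3"
   and gf: "\<And>i. g1 (f1 i) = g1 i" "\<And>i. g2 (f2 i) = g2 i" "\<And>i. g3 (f3 i) = g3 i"
    using fg1 fg2 fg3 by (auto simp: nc_intervals_def)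
  note le = bracketing_le[OF f(1)] bracketing_le[OF f(2)] bracketing_le[OF f(3)]
  have b1: "f1 i \<le> l" if "i \<le> l" for i using bracketing_less[OF f(1), of i] that by simp
  have b2: "f2 i \<le> m" if "i \<le> m" for i using bracketing_less[OF f(2), of i] that by simp
  have "l \<le> g1 l" using bracketing_le[OF g(1)] .
  then have gl: "g1 l = l" using bracketing_less[OF g(1), of l] by simp
  have "glue_upper l m g1 g2 g3 (glue_lower l f1 f2 f3 i) = glue_upper l m g1 g2 g3 i" for i
    unfolding glue_upper_def glue_lower_def glued_parts_apply[OF lm f] glued_parts_apply[OF lm g]
    using b1[of i] b2[of i] gl gf[of i] le[of i] lm by auto
  then show ?thesis
    using bracketing_glue_lower[OF lm f] bracketing_glue_upper[OF lm g]
    by (simp add: nc_intervals_def)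
qed

text \<open>
  Let \<open>l\<close> and \<open>m\<close> be the last points of the blocks of \<open>0\<close> in the finer and in the coarser partition. Then
  \<open>{1..l}\<close>, \<open>{l+1..m}\<close>, \<open>{m+1..n}\<close> are unions of finer blocks. The coarser partition is determined
  by its traces on these three sets, since on \<open>{1..l}\<close> the only block that it continues further is that of
  \<open>l\<close>. The traces are arbitrary intervals.
\<close>

lemma card_nc_intervals_rec:
  "card (nc_intervals 0 (Suc n)) =
   (\<Sum>m\<le>n. \<Sum>l\<le>m. card (nc_intervals 0 l) * card (nc_intervals 0 (m - l)) * card (nc_intervals 0 (n - m)))"
proof -
  define D where "D = Sigma {..n} (\<lambda>m. Sigma {..m} (\<lambda>l. nc_intervals 1 (Suc l) \<times>
     nc_intervals (Suc l) (Suc m) \<times> nc_intervals (Suc m) (Suc n)))"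
  define glue where "glue = (\<lambda>(m, l, (f1, g1), (f2, g2), (f3, g3)).
     (glue_lower l f1 f2 f3, glue_upper l m g1 g2 g3))"
  define cut where "cut = (\<lambda>(f :: nat \<Rightarrow> nat, g :: nat \<Rightarrow> nat). let l = f 0; m = g 0;
      R = (\<lambda>p q. (restrict_block p q f, restrict_block p q g))
      in (m, l, R 1 (Suc l), R (Suc l) (Suc m), R (Suc m) (Suc n)))"
  have "bij_betw glue D (nc_intervals 0 (Suc n))"
  proof (rule bij_betw_byWitness[where f' = cut])
    show "glue ` D \<subseteq> nc_intervals 0 (Suc n)"
      using nc_intervals_glue by (auto simp: glue_def D_def)
    have "cut (f, g) \<in> D" if fg: "(f, g) \<in> nc_intervals 0 (Suc n)" for f g
    proof -
      from fg have f: "bracketing 0 (Suc n) f" and g: "bracketing 0 (Suc n) g"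
        and gf: "\<And>i. g (f i) = g i" by (auto simp: nc_intervals_def)
      have "f 0 \<le> g 0" using gf[of 0] bracketing_le[OF g, of "f 0"] by simp
      moreover have "g 0 \<le> n" using bracketing_less[OF g, of 0] by simp
      moreover have fleg: "f i \<le> g i" for i using gf[of i] bracketing_le[OF g, of "f i"] by simp
      moreover have "f i < Suc (f 0)" if "i < Suc (f 0)" for i
        using bracketing_nested[OF f, of 0 i] that by simp
      moreover have "f i < Suc (g 0)" if "i < Suc (g 0)" for i
        using bracketing_nested[OF g, of 0 i] fleg[of i] that by simp
      moreover have "f i < Suc n" if "i < Suc n" for i
        using bracketing_less[OF f that] .
      ultimately show "cut (f, g) \<in> D"
        using nc_intervals_restrict[OF fg] by (auto simp: cut_def D_def Let_def)
    qed
    then show "cut ` nc_intervals 0 (Suc n) \<subseteq> D" by (intro image_subsetI) auto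
    show "\<forall>a\<in>nc_intervals 0 (Suc n). glue (cut a) = a"
    proof clarify
      fix f g assume fg: "(f, g) \<in> nc_intervals 0 (Suc n)"
      then have f: "bracketing 0 (Suc n) f" and g: "bracketing 0 (Suc n) g"
        and gf: "\<And>i. g (f i) = g i" by (auto simp: nc_intervals_def)
      have lm: "f 0 \<le> g 0" using gf[of 0] bracketing_le[OF g, of "f 0"] by simp
      have mn: "g 0 \<le> n" using bracketing_less[OF g, of 0] by simp
      note br = bracketing_restrict[OF f] bracketing_restrict[OF g]
      have fi: "f i = glue_lower (f 0) (restrict_block 1 (Suc (f 0)) f)
         (restrict_block (Suc (f 0)) (Suc (g 0)) f) (restrict_block (Suc (g 0)) (Suc n) f) i" for i
      proof -
        have "f i \<le> g i" using gf[of i] bracketing_le[OF g, of "f i"] by simp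
        then show ?thesis
          unfolding glue_lower_def glued_parts_apply[OF lm mn br(1) br(1) br(1)]
          using bracketing_nested[OF f, of 0 i] bracketing_nested[OF g, of 0 i]
            bracketing_less[OF f, of i] bracketing_outside[OF f, of i]
          by (auto simp: restrict_block_def)
      qed
      have gi: "g i = glue_upper (f 0) (g 0) (restrict_block 1 (Suc (f 0)) g)
         (restrict_block (Suc (f 0)) (Suc (g 0)) g) (restrict_block (Suc (g 0)) (Suc n) g) i" for i
      proof -
        consider "i = 0" | "0 < i" "i \<le> f 0" "f 0 \<le> g i" | "0 < i" "i \<le> f 0" "g i < f 0" | "f 0 < i"
          by linarith
        then show ?thesis
        proof cases
          case 1
          then show ?thesis by (simp add: glue_upper_def)
        next
          case 2
          have "g i = g 0"
          proof (rule antisym)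
            show "g i \<le> g 0" using bracketing_nested[OF g, of 0 i] lm 2 by simp
            show "g 0 \<le> g i" using bracketing_nested[OF g, of i "f 0"] gf[of 0] 2 by simp
          qed
          moreover have "restrict_block 1 (Suc (f 0)) g i = f 0"
            using 2 by (simp add: restrict_block_def)
          ultimately show ?thesis
            using 2 by (simp add: glue_upper_def)
        next
          case 3
          then show ?thesis
            unfolding glue_upper_def glued_parts_apply[OF lm mn br(2) br(2) br(2)]
            by (simp add: restrict_block_def)
        next
          case 4
          then show ?thesis
            unfolding glue_upper_def glued_parts_apply[OF lm mn br(2) br(2) br(2)]
            using bracketing_nested[OF g, of 0 i] bracketing_less[OF g, of i] bracketing_outside[OF g, of i]
            by (auto simp: restrict_block_def)
        qed
      qed
      show "glue (cut (f, g)) = (f, g)"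
        by (simp add: glue_def cut_def Let_def fun_eq_iff flip: fi[unfolded One_nat_def] gi[unfolded One_nat_def])
    qed
    show "\<forall>a\<in>D. cut (glue a) = a"
    proof
      fix a assume aD: "a \<in> D"
      obtain m l f1 g1 f2 g2 f3 g3 where a: "a = (m, l, (f1, g1), (f2, g2), (f3, g3))"
        by (metis surj_pair)
      have lm: "l \<le> m" "m \<le> n"
        and fg: "(f1, g1) \<in> nc_intervals 1 (Suc l)" "(f2, g2) \<in> nc_intervals (Suc l) (Suc m)"
         "(f3, g3) \<in> nc_intervals (Suc m) (Suc n)"
        using aD by (auto simp: a D_def)
      have f: "bracketing 1 (Suc l) f1" "bracketing (Suc l) (Suc m) f2" "bracketing (Suc m) (Suc n) f3"
       and g: "bracketing 1 (Suc l) g1" "bracketing (Suc l) (Suc m) g2" "bracketing (Suc m) (Suc n) g3"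
        using fg by (auto simp: nc_intervals_def)
      note F = glue_lower_def glued_parts_apply[OF lm f] and G = glue_upper_def glued_parts_apply[OF lm g]
      have "restrict_block 1 (Suc l) (glue_lower l f1 f2 f3) i = f1 i" for i
        using bracketing_less[OF f(1), of i] bracketing_outside[OF f(1), of i]
        by (auto simp: restrict_block_def F min_def split: if_splits)
      moreover have "restrict_block (Suc l) (Suc m) (glue_lower l f1 f2 f3) i = f2 i" for i
        using bracketing_less[OF f(2), of i] bracketing_outside[OF f(2), of i]
        by (auto simp: restrict_block_def F min_def split: if_splits)
      moreover have "restrict_block (Suc m) (Suc n) (glue_lower l f1 f2 f3) i = f3 i" for i
        using bracketing_less[OF f(3), of i] bracketing_outside[OF f(3), of i] lm
        by (auto simp: restrict_block_def F min_def split: if_splits)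
      moreover have "restrict_block 1 (Suc l) (glue_upper l m g1 g2 g3) i = g1 i" for i
        using bracketing_less[OF g(1), of i] bracketing_outside[OF g(1), of i] lm
        by (auto simp: restrict_block_def G min_def split: if_splits)
      moreover have "restrict_block (Suc l) (Suc m) (glue_upper l m g1 g2 g3) i = g2 i" for i
        using bracketing_less[OF g(2), of i] bracketing_outside[OF g(2), of i] lm
        by (auto simp: restrict_block_def G min_def split: if_splits)
      moreover have "restrict_block (Suc m) (Suc n) (glue_upper l m g1 g2 g3) i = g3 i" for i
        using bracketing_less[OF g(3), of i] bracketing_outside[OF g(3), of i] lm
        by (auto simp: restrict_block_def G min_def split: if_splits)
      ultimately show "cut (glue a) = a"
        by (simp add: a glue_def cut_def Let_def glue_lower_def[of _ _ _ _ 0] glue_upper_def[of _ _ _ _ _ 0] fun_eq_iff)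
    qed
  qed
  then have "card (nc_intervals 0 (Suc n)) = card D" by (simp add: bij_betw_same_card)
  also have "\<dots> = (\<Sum>m\<le>n. \<Sum>l\<le>m. card (nc_intervals 1 (Suc l)) *
     (card (nc_intervals (Suc l) (Suc m)) * card (nc_intervals (Suc m) (Suc n))))"
    unfolding D_def by (simp add: card_SigmaI finite_nc_intervals card_cartesian_product)
  also have "\<dots> = (\<Sum>m\<le>n. \<Sum>l\<le>m. card (nc_intervals 0 l) * card (nc_intervals 0 (m - l)) * card (nc_intervals 0 (n - m)))"
  proof (intro sum.cong refl)
    fix m l assume "m \<in> {..n}" "l \<in> {..m}"
    then show "card (nc_intervals 1 (Suc l)) *
     (card (nc_intervals (Suc l) (Suc m)) * card (nc_intervals (Suc m) (Suc n)))
     = card (nc_intervals 0 l) * card (nc_intervals 0 (m - l)) * card (nc_intervals 0 (n - m))"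
      using card_nc_intervals[of 1 l] card_nc_intervals[of "Suc l" "m - l"]
        card_nc_intervals[of "Suc m" "n - m"] by simp
  qed
  finally show ?thesis .
qed

lemma nc_intervals_empty: "nc_intervals 0 0 = {(id, id)}"
  by (auto simp: nc_intervals_def bracketing_def fun_eq_iff)

text \<open>
  Lagrange inversion for \<open>T = 1 + x T\<^sup>3\<close>. It is proved for all powers of \<open>T\<close> at once because multiplying
  the equation by \<open>T\<^sup>r\<close> gives a recursion on the pair \<open>(n, r)\<close>, which the closed form
  satisfies by Pascal's rule and the absorption identity. The factor \<open>3n + r\<close> is kept on the left because it vanishes for \<open>n = r = 0\<close>.
\<close>

lemma fps_power_fixed_point_nth:
  fixes T :: "real fps"
  assumes T: "T = 1 + fps_X * T ^ 3"
  shows "real (3 * n + r) * fps_nth (T ^ r) n = real r * real ((3 * n + r) choose n)"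
proof (induction n arbitrary: r)
  case 0
  have "fps_nth T 0 = 1" by (subst T) simp
  then show ?case by (simp add: fps_power_zeroth)
next
  case (Suc n)
  show ?case
  proof (induction r)
    case 0
    show ?case by simp
  next
    case (Suc r)
    let ?M = "3 * Suc n + r"
    have "T ^ Suc r = T ^ r + fps_X * T ^ (r + 3)"
    proof -
      have "T ^ Suc r = T ^ r * (1 + fps_X * T ^ 3)" by (subst (1) T[symmetric]) (simp add: mult.commute)
      then show ?thesis by (simp add: algebra_simps power_add)
    qed
    then have "fps_nth (T ^ Suc r) (Suc n) = fps_nth (T ^ r) (Suc n) + fps_nth (T ^ (r + 3)) n" by simp
    then have "real ?M * fps_nth (T ^ Suc r) (Suc n) = real ?M * fps_nth (T ^ r) (Suc n) + real (3 * n + (r + 3)) * fps_nth (T ^ (r + 3)) n"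
      by (simp add: algebra_simps)
    also have "\<dots> = real r * real (?M choose Suc n) + real (r + 3) * real (?M choose n)"
      unfolding Suc.IH \<open>\<And>r. real (3 * n + r) * fps_nth (T ^ r) n = real r * real ((3 * n + r) choose n)\<close>
      by (simp add: algebra_simps)
    finally have rec: "real ?M * fps_nth (T ^ Suc r) (Suc n) =
      real r * real (?M choose Suc n) + real (r + 3) * real (?M choose n)" .
    have 1: "real (Suc ?M) * real (?M choose n) = real (Suc n) * real (Suc ?M choose Suc n)"
      by (metis Suc_times_binomial_eq mult.commute of_nat_mult)
    have 2: "real (?M choose Suc n) = real (Suc ?M choose Suc n) - real (?M choose n)"
      unfolding binomial_Suc_Suc by simp
    have "real (Suc ?M) * (real ?M * fps_nth (T ^ Suc r) (Suc n))
      = real (Suc ?M) * (real r * real (Suc ?M choose Suc n)) + 3 * (real (Suc ?M) * real (?M choose n))"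
      unfolding rec 2 by (simp add: algebra_simps)
    also have "\<dots> = real ?M * (real (Suc r) * real (Suc ?M choose Suc n))"
      unfolding 1 by (simp add: algebra_simps)
    finally have "real ?M * (real (Suc ?M) * fps_nth (T ^ Suc r) (Suc n))
       = real ?M * (real (Suc r) * real (Suc ?M choose Suc n))" by (simp only: mult_ac)
    then have "real (Suc ?M) * fps_nth (T ^ Suc r) (Suc n) = real (Suc r) * real (Suc ?M choose Suc n)"
      by (subst (asm) mult_cancel_left) auto
    then show ?case by simp
  qed
qed

lemma card_nc_intervals_closed:
  "real (card (nc_intervals 0 n)) = 1 / (2 * real n + 1) * real ((3 * n) choose n)"
proof -
  define T where "T = Abs_fps (\<lambda>n. real (card (nc_intervals 0 n)))"
  have "T = 1 + fps_X * T ^ 3"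
  proof (rule fps_ext)
    fix n
    show "fps_nth T n = fps_nth (1 + fps_X * T ^ 3) n"
    proof (cases n)
      case 0
      then show ?thesis by (simp add: T_def nc_intervals_empty)
    next
      case (Suc m)
      have "fps_nth (1 + fps_X * T ^ 3) (Suc m) = fps_nth (T * T * T) m"
        by (simp add: power3_eq_cube)
      then show ?thesis
        by (simp add: Suc T_def card_nc_intervals_rec fps_mult_nth sum_distrib_right atLeast0AtMost)
    qed
  qed
  from fps_power_fixed_point_nth[OF this, of n 1]
  have "real (3 * n + 1) * real (card (nc_intervals 0 n)) = real ((3 * n + 1) choose n)"
    by (simp add: T_def)
  moreover have "real (2 * n + 1) * real ((3 * n + 1) choose n) = real (3 * n + 1) * real ((3 * n) choose n)"
  proof -
    have "(3 * n + 1 - n) * ((3 * n + 1) choose n) = (3 * n + 1) * ((3 * n) choose n)"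
      using binomial_absorb_comp[of "3 * n + 1" n] by simp
    then have "(2 * n + 1) * ((3 * n + 1) choose n) = (3 * n + 1) * ((3 * n) choose n)" by simp
    then show ?thesis by (metis of_nat_mult)
  qed
  ultimately have "real (3 * n + 1) * ((2 * real n + 1) * real (card (nc_intervals 0 n))) = real (3 * n + 1) * real ((3 * n) choose n)"
    by (simp add: algebra_simps)
  then have "(2 * real n + 1) * real (card (nc_intervals 0 n)) = real ((3 * n) choose n)"
    by (subst (asm) mult_cancel_left) auto
  then show ?thesis by (simp add: field_simps)
qed

section \<open>Sums and multisets indexed by time\<close>

lemma sum_period_window:
  fixes g :: "nat \<Rightarrow> 'b :: ab_group_add"
  assumes per: "\<And>t. g (t + n) = g t"
  shows "(\<Sum>s = a..<a + n. g s) = (\<Sum>s<n. g s)"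
proof (induction a)
  case 0
  then show ?case by (simp add: atLeast0LessThan)
next
  case (Suc a)
  have "(\<Sum>s = Suc a..<Suc (a + n). g s) + g a = (\<Sum>s = a..<Suc (a + n). g s)"
    by (subst (2) sum.atLeast_Suc_lessThan) auto
  also have "\<dots> = (\<Sum>s = a..<a + n. g s) + g (a + n)" by simp
  finally have "(\<Sum>s = Suc a..<Suc a + n. g s) = (\<Sum>s = a..<a + n. g s)"
    by (simp add: per)
  then show ?case using Suc.IH by simp
qed

text \<open>
  With \<open>d s\<close> indicating that a walk is at a given vertex at time \<open>s\<close>, the sum counts the edge ends
  at that vertex, and every visit strictly between \<open>a\<close> and \<open>b\<close> contributes two of them.
\<close>

lemma even_telescope:
  fixes d :: "nat \<Rightarrow> nat"
  assumes "a \<le> b"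
  shows "even (\<Sum>s = a..<b. d s + d (Suc s)) \<longleftrightarrow> even (d a + d b)"
  using assms by (induction b rule: dec_induct) auto

lemma sum_double: "(\<Sum>t<2 * k. F t) = (\<Sum>i<k. F (2 * i) + F (2 * i + 1))"
  for F :: "nat \<Rightarrow> 'b :: comm_monoid_add"
  by (induction k) (simp_all add: add.assoc)

lemma image_mset_sum_lessThan: "image_mset h (\<Sum>t<n. M t) = (\<Sum>t<n. image_mset h (M t))" for n :: nat
  by (induction n) simp_all

lemma count_sum_lessThan: "count (\<Sum>t<n. M t) e = (\<Sum>t<n. count (M t) e)" for n :: nat
  by (induction n) simp_all

section \<open>Two coupled closed walks and the bound on their classes\<close>

definition walk_edge :: "(bool \<Rightarrow> nat \<Rightarrow> 'c) \<Rightarrow> bool \<Rightarrow> nat \<Rightarrow> 'c set" where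
  "walk_edge W j t = {W j t, W j (Suc t)}"

text \<open>
  At an even time the layer consists of \<open>a\<close>-vertices and the diagonal leaves from the second row
  (\<open>False\<close>), at an odd time it consists of \<open>b\<close>-vertices and the diagonal leaves from the first row (\<open>True\<close>).
\<close>

definition diag_edge :: "(bool \<Rightarrow> nat \<Rightarrow> 'c) \<Rightarrow> nat \<Rightarrow> 'c set" where
  "diag_edge W t = {W (odd t) t, W (even t) (Suc t)}"

definition step_edges :: "(bool \<Rightarrow> nat \<Rightarrow> 'c) \<Rightarrow> nat \<Rightarrow> 'c set multiset" where
  "step_edges W t = {#walk_edge W True t, walk_edge W False t, diag_edge W t#}"

text \<open>
  The walk \<open>W j\<close> gives the classes of the vertices of row \<open>j\<close> of the strip, where \<open>True\<close> stands for the
  first and \<open>False\<close> for the second row. Time runs through all natural numbers with period \<open>2k\<close>,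
  so that the strip can be read from any layer on.
\<close>

locale double_walk =
  fixes k :: nat and W :: "bool \<Rightarrow> nat \<Rightarrow> 'c"
  assumes k_pos: "0 < k"
    and periodic: "W j (t + 2 * k) = W j t"
    and layer_distinct: "W True t \<noteq> W False t"
    and adjacent_distinct: "W i t \<noteq> W j (Suc t)"
    and even_edges: "even (\<Sum>t<2 * k. count (step_edges W t) e)"
begin

definition layer :: "nat \<Rightarrow> 'c set" where
  "layer t = range (\<lambda>j. W j t)"

lemma layer_iff: "x \<in> layer t \<longleftrightarrow> (\<exists>j. W j t = x)"
  by (auto simp: layer_def)

lemma in_layer [simp]: "W j t \<in> layer t"
  by (auto simp: layer_def)

lemma same_layer: "W i t = W j t \<longleftrightarrow> i = j"
  using layer_distinct[of t] by (cases i; cases j) auto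

lemma layer_periodic [simp]: "layer (t + 2 * k) = layer t"
  by (simp add: layer_def periodic)

lemma adjacent_notin: "W i t \<notin> layer (Suc t)" "W i (Suc t) \<notin> layer t"
  using adjacent_distinct by (auto simp: layer_iff) metis+

lemma even_edges_window: "even (\<Sum>s = a..<a + 2 * k. count (step_edges W s) e)"
proof -
  have "step_edges W (t + 2 * k) = step_edges W t" for t
    using periodic[of _ t] periodic[of _ "Suc t"]
    by (simp add: step_edges_def walk_edge_def diag_edge_def)
  then have "(\<Sum>s = a..<a + 2 * k. int (count (step_edges W s) e)) = (\<Sum>t<2 * k. int (count (step_edges W t) e))"
    by (intro sum_period_window) simp
  then have "(\<Sum>s = a..<a + 2 * k. count (step_edges W s) e) = (\<Sum>t<2 * k. count (step_edges W t) e)"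
    by (simp flip: of_nat_sum)
  then show ?thesis using even_edges[of e] by simp
qed

lemma no_unique_edge:
  assumes s: "a \<le> s" "s < a + 2 * k" and e: "walk_edge W i s = e"
    and diag: "\<And>s'. a \<le> s' \<Longrightarrow> s' < a + 2 * k \<Longrightarrow> diag_edge W s' \<noteq> e"
    and uniq: "\<And>j s'. a \<le> s' \<Longrightarrow> s' < a + 2 * k \<Longrightarrow> walk_edge W j s' = e \<Longrightarrow> j = i \<and> s' = s"
  shows False
proof -
  have "count (step_edges W s') e = (if s' = s then 1 else 0)" if "s' \<in> {a..<a + 2 * k}" for s'
  proof -
    have "walk_edge W j s' = e \<longleftrightarrow> j = i \<and> s' = s" for j using uniq[of s' j] that e by auto
    moreover have "diag_edge W s' \<noteq> e" using diag that by simp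
    ultimately show ?thesis by (cases i; cases "s' = s") (simp_all add: step_edges_def)
  qed
  then have "(\<Sum>s = a..<a + 2 * k. count (step_edges W s) e) = (\<Sum>s'\<in>{a..<a + 2 * k}. if s' = s then 1 else 0)"
    by (intro sum.cong) auto
  also have "\<dots> = 1" using s by simp
  finally show False using even_edges_window[where a = a and e = e] by simp
qed

definition classes :: "'c set" where
  "classes = (\<Union>t<2 * k. layer t)"

lemma layer_mod: "layer (t mod (2 * k)) = layer t"
proof -
  have "layer (s + m * (2 * k)) = layer s" for s m
    by (induction m) (simp_all, metis add.assoc add.commute layer_periodic mult_2)
  from this[of "t mod (2 * k)" "t div (2 * k)"] show ?thesis by (simp only: mod_div_mult_eq)
qed

lemma classes_window: "classes = (\<Union>t\<in>{c..<c + 2 * k}. layer t)"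
proof -
  have "layer t \<subseteq> (\<Union>t\<in>{c..<c + 2 * k}. layer t)" if "t < 2 * k" for t
  proof -
    define s where "s = c + (t + 2 * k - c mod (2 * k)) mod (2 * k)"
    have "s \<in> {c..<c + 2 * k}" using k_pos by (simp add: s_def)
    moreover have "layer s = layer t"
    proof -
      have "s mod (2 * k) = (c mod (2 * k) + (t + 2 * k - c mod (2 * k))) mod (2 * k)"
        unfolding s_def by (simp add: mod_simps)
      also have "c mod (2 * k) + (t + 2 * k - c mod (2 * k)) = t + 2 * k"
        using mod_less_divisor[of "2 * k" c] k_pos by linarith
      finally have "s mod (2 * k) = t" using that by simp
      then show ?thesis using layer_mod[of s] by simp
    qed
    ultimately show ?thesis by blast
  qed
  then have "classes \<subseteq> (\<Union>t\<in>{c..<c + 2 * k}. layer t)"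
    unfolding classes_def by blast
  moreover have "layer t \<subseteq> classes" for t
  proof -
    have "t mod (2 * k) \<in> {..<2 * k}" using k_pos by simp
    then show ?thesis unfolding classes_def layer_mod[of t, symmetric] by blast
  qed
  ultimately show ?thesis by blast
qed

text \<open>
  Reading starts at layer \<open>c\<close> and ends at layer \<open>c + 2k\<close>, which is layer \<open>c\<close> again. So the classes of the cut
  layer are never newcomers and never depart.
\<close>

definition newcomer :: "nat \<Rightarrow> bool \<Rightarrow> nat \<Rightarrow> bool" where
  "newcomer c j t \<longleftrightarrow> (\<forall>s\<in>{c..t}. W j (Suc t) \<notin> layer s)"

definition departing :: "nat \<Rightarrow> bool \<Rightarrow> nat \<Rightarrow> bool" where
  "departing c j t \<longleftrightarrow> (\<forall>s\<in>{Suc t..c + 2 * k}. W j t \<notin> layer s)"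

definition slots :: "nat \<Rightarrow> (bool \<times> nat) set" where
  "slots c = UNIV \<times> {c..<c + 2 * k}"

lemma card_slots: "card (slots c) = 4 * k" "finite (slots c)"
  by (simp_all add: slots_def card_cartesian_product)

definition arrivals :: "nat \<Rightarrow> (bool \<times> nat) set" where
  "arrivals c = {x \<in> slots c. newcomer c (fst x) (snd x)}"

definition departures :: "nat \<Rightarrow> (bool \<times> nat) set" where
  "departures c = {x \<in> slots c. departing c (fst x) (snd x)}"

lemma finite_arrivals: "finite (arrivals c)" "finite (departures c)"
  using card_slots(2)[of c] by (simp_all add: arrivals_def departures_def)

text \<open>
  A class last met at time \<open>t\<close> and a class first met at time \<open>t + 1\<close> are both present only during
  step \<open>t\<close>, so the edge between them has multiplicity one.
\<close>

lemma not_newcomer_and_departing: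
  assumes t: "c \<le> t" "t < c + 2 * k"
  shows "\<not> (newcomer c j t \<and> departing c j t)"
proof
  assume nd: "newcomer c j t \<and> departing c j t"
  let ?u = "W j t" and ?v = "W j (Suc t)"
  have u: "W i s \<noteq> ?u" if "Suc t \<le> s" "s \<le> c + 2 * k" for i s
    using nd that by (auto simp: departing_def layer_iff)
  have v: "W i s \<noteq> ?v" if "c \<le> s" "s \<le> t" for i s
    using nd that by (auto simp: newcomer_def layer_iff)
  have key: "s = t \<and> i = j \<and> i' = j" if s: "c \<le> s" "s < c + 2 * k" and e: "{W i s, W i' (Suc s)} = {?u, ?v}" for i i' s
  proof -
    have "s = t"
    proof (rule ccontr)
      assume "s \<noteq> t"
      then consider "Suc s \<le> t" | "Suc t \<le> s" by linarith
      then show False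
      proof cases
        case 1
        then show False using v[of s i] v[of "Suc s" i'] s e by (auto simp: doubleton_eq_iff)
      next
        case 2
        then show False using u[of s i] u[of "Suc s" i'] s e by (auto simp: doubleton_eq_iff)
      qed
    qed
    moreover have "W i t = ?u \<and> W i' (Suc t) = ?v"
      using e \<open>s = t\<close> v[of t i] t by (auto simp: doubleton_eq_iff)
    ultimately show ?thesis using same_layer by auto
  qed
  show False
  proof (rule no_unique_edge[of c t j "{?u, ?v}"])
    show "walk_edge W j t = {?u, ?v}" by (simp add: walk_edge_def)
    show "diag_edge W s' \<noteq> {?u, ?v}" if "c \<le> s'" "s' < c + 2 * k" for s'
      using key[OF that] by (auto simp: diag_edge_def)
    show "j' = j \<and> s' = t" if "c \<le> s'" "s' < c + 2 * k" "walk_edge W j' s' = {?u, ?v}" for j' s'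
      using key[OF that(1,2)] that(3) by (auto simp: walk_edge_def)
  qed (use t in auto)
qed

lemma card_layer: "card (layer c) = 2"
proof -
  have "layer c = {W True c, W False c}" unfolding layer_def UNIV_bool by auto
  then show ?thesis by (simp add: layer_distinct)
qed

lemma classes_le_newcomers: "card classes - 2 \<le> card (arrivals c)"
proof -
  have "classes - layer c \<subseteq> (\<lambda>(j, t). W j (Suc t)) ` arrivals c"
  proof
    fix x assume x: "x \<in> classes - layer c"
    define P where "P s \<longleftrightarrow> x \<in> layer s \<and> c \<le> s" for s
    obtain s0 where s0: "s0 \<in> {c..<c + 2 * k}" "x \<in> layer s0" using x classes_window[of c] by auto
    define s where "s = (LEAST s. P s)"
    have Ps: "P s" unfolding s_def by (rule LeastI[of _ s0]) (use s0 in \<open>auto simp: P_def\<close>)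
    have min: "\<not> P r" if "r < s" for r using that not_less_Least unfolding s_def by blast
    have "s \<le> s0" unfolding s_def by (rule Least_le) (use s0 in \<open>auto simp: P_def\<close>)
    have "s \<noteq> c" using x Ps by (auto simp: P_def)
    then obtain t where t: "s = Suc t" "c \<le> t" using Ps by (cases s) (auto simp: P_def)
    obtain j where j: "W j (Suc t) = x" using Ps t by (auto simp: P_def layer_iff)
    have "newcomer c j t" using min t j by (auto simp: newcomer_def P_def)
    moreover have "t < c + 2 * k" using \<open>s \<le> s0\<close> s0 t by auto
    ultimately show "x \<in> (\<lambda>(j, t). W j (Suc t)) ` arrivals c"
      using t j by (auto simp: arrivals_def slots_def intro!: image_eqI[of _ _ "(j, t)"])
  qed
  then have "card (classes - layer c) \<le> card (arrivals c)"
    by (rule surj_card_le[OF finite_arrivals(1)])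
  then show ?thesis using diff_card_le_card_Diff[of "layer c" classes] card_layer[of c]
    by (simp add: layer_def)
qed

lemma classes_le_departing: "card classes - 2 \<le> card (departures c)"
proof -
  have "classes - layer (c + 2 * k) \<subseteq> (\<lambda>(j, t). W j t) ` departures c"
  proof
    fix x assume x: "x \<in> classes - layer (c + 2 * k)"
    define A where "A = {s \<in> {c..<c + 2 * k}. x \<in> layer s}"
    have A: "finite A" "A \<noteq> {}" using x classes_window[of c] by (auto simp: A_def)
    define t where "t = Max A"
    have tA: "t \<in> A" unfolding t_def using A by (rule Max_in)
    have max: "s \<le> t" if "s \<in> A" for s unfolding t_def using A that by simp
    obtain j where j: "W j t = x" using tA by (auto simp: A_def layer_iff)
    have "x \<notin> layer s" if "Suc t \<le> s" "s \<le> c + 2 * k" for s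
      using max[of s] x that tA by (cases "s = c + 2 * k") (auto simp: A_def)
    then have "departing c j t" by (auto simp: departing_def j)
    then show "x \<in> (\<lambda>(j, t). W j t) ` departures c"
      using tA j by (auto simp: departures_def slots_def A_def intro!: image_eqI[of _ _ "(j, t)"])
  qed
  then have "card (classes - layer (c + 2 * k)) \<le> card (departures c)"
    by (rule surj_card_le[OF finite_arrivals(2)])
  then show ?thesis using diff_card_le_card_Diff[of "layer (c + 2 * k)" classes] card_layer[of "c + 2 * k"]
    by (simp add: layer_def)
qed

lemma card_arrivals_departures:
  "card (arrivals c) + card (departures c) = card (arrivals c \<union> departures c)"
proof (rule card_Un_disjoint[symmetric, OF finite_arrivals])
  show "arrivals c \<inter> departures c = {}"
  proof (rule ccontr)
    assume "arrivals c \<inter> departures c \<noteq> {}"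
    then obtain j t where "(j, t) \<in> arrivals c" "(j, t) \<in> departures c" by auto
    then show False using not_newcomer_and_departing[of c t j]
      by (simp add: arrivals_def departures_def slots_def)
  qed
qed

lemma arrivals_departures_subset: "arrivals c \<union> departures c \<subseteq> slots c"
  unfolding arrivals_def departures_def by blast

text \<open>
  Each class outside the cut layer arrives in one of the \<open>4k\<close> slots and departs in another one.
\<close>

lemma card_classes_le: "card classes \<le> 2 * k + 2"
  using card_mono[OF card_slots(2) arrivals_departures_subset, of 0]
    classes_le_newcomers[of 0] classes_le_departing[of 0] card_arrivals_departures[of 0]
  unfolding card_slots by linarith

end

section \<open>Rigidity of the extremal walks\<close>

locale extremal_walk = double_walk +
  assumes extremal: "card classes = 2 * k + 2"
begin

lemma newcomer_or_departing:
  assumes t: "c \<le> t" "t < c + 2 * k"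
  shows "newcomer c j t \<or> departing c j t"
proof -
  have "arrivals c \<union> departures c = slots c"
  proof (rule card_seteq[OF card_slots(2) arrivals_departures_subset])
    show "card (slots c) \<le> card (arrivals c \<union> departures c)"
      using classes_le_newcomers[of c] classes_le_departing[of c] card_arrivals_departures[of c]
      unfolding card_slots extremal by linarith
  qed
  moreover have "(j, t) \<in> slots c" using t by (simp add: slots_def)
  ultimately have "(j, t) \<in> arrivals c \<union> departures c" by blast
  then show ?thesis by (auto simp: arrivals_def departures_def)
qed

text \<open>
  The next visit is allowed to take place in the other row; for extremal walks this turns out to be
  impossible.
\<close>

definition next_visit :: "bool \<Rightarrow> nat \<Rightarrow> nat \<Rightarrow> bool" where
  "next_visit j t T \<longleftrightarrow> t < T \<and> W j t \<in> layer T \<and> (\<forall>s. t < s \<longrightarrow> s < T \<longrightarrow> W j t \<notin> layer s)"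

lemma next_visit_exists: "\<exists>T \<le> t + 2 * k. next_visit j t T"
proof -
  define T where "T = (LEAST T. t < T \<and> W j t \<in> layer T)"
  have ex: "t < t + 2 * k \<and> W j t \<in> layer (t + 2 * k)" using k_pos by simp
  have "t < T \<and> W j t \<in> layer T" unfolding T_def using ex by (rule LeastI)
  moreover have "T \<le> t + 2 * k" unfolding T_def using ex by (rule Least_le)
  moreover have "W j t \<notin> layer s" if "t < s" "s < T" for s
    using not_less_Least[of s "\<lambda>T. t < T \<and> W j t \<in> layer T"] that unfolding T_def by auto
  ultimately show ?thesis unfolding next_visit_def by blast
qed

lemma next_visit_le: "next_visit j t T \<Longrightarrow> T \<le> t + 2 * k"
proof (rule leI, rule notI)
  assume r: "next_visit j t T" and "t + 2 * k < T"
  moreover have "t < t + 2 * k" using k_pos by simp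
  ultimately have "W j t \<notin> layer (t + 2 * k)" unfolding next_visit_def by blast
  then show False by simp
qed

lemma next_visit_gap: "next_visit j t T \<Longrightarrow> Suc (Suc t) \<le> T"
proof -
  assume r: "next_visit j t T"
  then have "T \<noteq> Suc t" using adjacent_notin(1)[of j t] unfolding next_visit_def by blast
  moreover have "t < T" using r unfolding next_visit_def by blast
  ultimately show ?thesis by linarith
qed

text \<open>
  Each step is exactly one of arriving and departing for every cut. For a cut at \<open>T\<close> the class
  \<open>W j t\<close> does not depart in step \<open>t\<close>, as it is met again at the end of the window, so \<open>W j (t + 1)\<close> is new. For a cut
  at \<open>T - 1\<close> it does depart, so \<open>W j (t + 1)\<close> was met before. The two windows differ only in the
  layer \<open>T - 1\<close>.
\<close>

lemma next_visit_child:
  assumes T: "next_visit j t T"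
  shows "W j (Suc t) \<in> layer (T - 1)"
    and "T \<le> s \<Longrightarrow> s \<le> t + 2 * k \<Longrightarrow> W j (Suc t) \<notin> layer s"
proof -
  note le = next_visit_le[OF T] next_visit_gap[OF T]
  have u: "W j (t + 2 * k) = W j t" and v: "W j (Suc (t + 2 * k)) = W j (Suc t)"
    using periodic[of j t] periodic[of j "Suc t"] by simp_all
  \<comment> \<open>Both windows are moved up by one period, so that they start at a natural number
    and contain step \<open>t + 2k\<close>.\<close>
  have "W j t \<in> layer (T + 2 * k)" using T by (simp add: next_visit_def)
  then have "\<not> departing T j (t + 2 * k)"
    using T le by (auto simp: departing_def u next_visit_def intro!: bexI[of _ "T + 2 * k"])
  then have "newcomer T j (t + 2 * k)" using newcomer_or_departing[of T "t + 2 * k" j] le T by (auto simp: next_visit_def)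
  then have new: "W j (Suc t) \<notin> layer s" if "T \<le> s" "s \<le> t + 2 * k" for s
    using that by (auto simp: newcomer_def v)
  show "T \<le> s \<Longrightarrow> s \<le> t + 2 * k \<Longrightarrow> W j (Suc t) \<notin> layer s" by (rule new)
  have "W j t \<notin> layer s" if "Suc (t + 2 * k) \<le> s" "s \<le> T - 1 + 2 * k" for s
  proof -
    have "W j t \<notin> layer (s - 2 * k)" using T that le by (auto simp: next_visit_def)
    then show ?thesis using layer_periodic[of "s - 2 * k"] that by simp
  qed
  then have "departing (T - 1) j (t + 2 * k)" by (auto simp: departing_def u)
  then have "\<not> newcomer (T - 1) j (t + 2 * k)"
    using not_newcomer_and_departing[of "T - 1" "t + 2 * k" j] le by auto
  then obtain s where s: "T - 1 \<le> s" "s \<le> t + 2 * k" "W j (Suc t) \<in> layer s"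
    by (auto simp: newcomer_def v)
  have "\<not> T \<le> s" using new[of s] s by blast
  then have "s = T - 1" using s by linarith
  then show "W j (Suc t) \<in> layer (T - 1)" using s by simp
qed

text \<open>
  Two visits of a class are connected by a chain of next visits.
\<close>

lemma chain_same_row:
  assumes short: "\<And>j t T. next_visit j t T \<Longrightarrow> T - t < n \<Longrightarrow> W j T = W j t \<and> even (T - t)"
    and pq: "p \<le> q" "q - p < n" and eq: "W i q = W j p"
  shows "i = j \<and> even (q - p)"
  using pq eq
proof (induction "q - p" arbitrary: p rule: less_induct)
  case less
  show ?case
  proof (cases "p = q")
    case True
    then show ?thesis using less.prems same_layer by auto
  next
    case False
    obtain T where T: "next_visit j p T" using next_visit_exists by blast
    have "W j p \<in> layer q" using less.prems(3) in_layer[of i q] by simp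
    then have Tq: "T \<le> q" using T less.prems(1) False by (auto simp: next_visit_def intro: leI)
    have pT: "p < T" using T by (simp add: next_visit_def)
    have row: "W j T = W j p \<and> even (T - p)"
      using T by (rule short) (use less.prems(2) Tq in linarith)
    have "i = j \<and> even (q - T)"
      using less.hyps[of T] Tq pT less.prems row by auto
    then show ?thesis using row Tq pT by auto
  qed
qed

text \<open>
  Suppose that \<open>u = W j t\<close> is next visited in the other row and that \<open>T - t\<close> is as small as possible. The classes entered
  at time \<open>t + 1\<close> in the two rows are then confined to the times \<open>t + 1, \<dots>, T - 1\<close> and, by
  minimality, to their own rows and to one parity. One of the two carries no diagonal
  edges. It is adjacent to \<open>u\<close> only at the beginning or only at the end of this time
  span, because \<open>u\<close> is met there in different rows. So that edge has multiplicity one.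
\<close>

lemma next_visit_same_row: "next_visit j t T \<Longrightarrow> W j T = W j t \<and> even (T - t)"
proof (induction "T - t" arbitrary: j t T rule: less_induct)
  case less
  note ret = \<open>next_visit j t T\<close>
  define n where "n = T - t"
  have le: "T \<le> t + 2 * k" "Suc (Suc t) \<le> T" using next_visit_le[OF ret] next_visit_gap[OF ret] by auto
  have chain: "r = r' \<and> even (q - p)" if "p \<le> q" "q - p < n" "W r q = W r' p" for p q r r'
    by (rule chain_same_row[of n, OF _ that]) (use less.hyps n_def in blast)
  have no_u: "W r s \<noteq> W j t" if "t < s" "s < T" for r s
    using ret that by (auto simp: next_visit_def layer_iff)
  have child_last: "W j (Suc t) \<notin> layer s" if "T \<le> s" "s \<le> t + 2 * k" for s
    using next_visit_child(2)[OF ret that] .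
  obtain r where r: "W r (T - 1) = W j (Suc t)" using next_visit_child(1)[OF ret] by (auto simp: layer_iff)
  have "r = j \<and> even (T - 1 - Suc t)" by (rule chain) (use le r n_def in auto)
  then have child: "W j (T - 1) = W j (Suc t)" and "even (T - 1 - Suc t)" using r by auto
  moreover have "T - t = Suc (Suc (T - 1 - Suc t))" using le by linarith
  ultimately have evn: "even (T - t)" by simp
  have "W j T = W j t"
  proof (rule ccontr)
    assume cross: "W j T \<noteq> W j t"
    obtain j' where j': "W j' T = W j t" using ret by (auto simp: next_visit_def layer_iff)
    then have jj': "j' = (\<not> j)" using cross by (cases j; cases j') auto
    \<comment> \<open>The same rule applied to the step from \<open>T - 1\<close> to \<open>T\<close> in row \<open>j'\<close>, whose end is \<open>u\<close>:
      the class left in that step is next met right after the last visit of \<open>u\<close> before \<open>T + 2k\<close>.\<close>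
    obtain T' where T': "next_visit j' (T - 1) T'" using next_visit_exists by blast
    have Suc_T: "Suc (T - 1) = T" "Suc (T - Suc 0) = T" using le by simp_all
    have le': "T' \<le> T - 1 + 2 * k" "T - 1 < T'"
      using next_visit_le[OF T'] T' by (auto simp: next_visit_def)
    have "\<not> T' \<le> t + 2 * k"
    proof -
      have u: "W j t \<in> layer (t + 2 * k)" by simp
      have "t + 2 * k \<le> T - 1 + 2 * k" using le by linarith
      then show ?thesis using next_visit_child(2)[OF T', of "t + 2 * k"] u unfolding Suc_T j' by blast
    qed
    moreover have "\<not> t + 2 * k < T' - 1"
    proof
      assume "t + 2 * k < T' - 1"
      moreover have "W j t \<in> layer (T' - 1)" using next_visit_child(1)[OF T'] unfolding Suc_T j' .
      then have "W j t \<in> layer (T' - 1 - 2 * k)"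
        using layer_periodic[of "T' - 1 - 2 * k"] calculation by simp
      ultimately show False
        using ret le' le by (auto simp: next_visit_def)
    qed
    ultimately have T'_eq: "T' = Suc (t + 2 * k)" by linarith
    have "W j' (T - 1) \<in> layer (Suc t)"
      using T' layer_periodic[of "Suc t"] by (simp add: next_visit_def T'_eq)
    then obtain i where i: "W i (Suc t) = W j' (T - 1)" by (auto simp: layer_iff)
    have "j' = i \<and> even (T - 1 - Suc t)" by (rule chain) (use le i n_def in auto)
    then have companion: "W j' (T - 1) = W j' (Suc t)" using i by simp
    have companion_last: "W j' (Suc t) \<notin> layer s" if "T \<le> s" "s \<le> t + 2 * k" for s
    proof -
      have "T - 1 < s" "s < T'" using that le by (simp_all add: T'_eq)
      then show ?thesis using T' companion unfolding next_visit_def by metis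
    qed
    \<comment> \<open>The row whose vertices at times of the parity of \<open>t + 1\<close> have no diagonal edges.\<close>
    define i where "i = even (Suc t)"
    define x where "x = W i (Suc t)"
    have ij: "i = j \<or> i = j'" using jj' by auto
    have x_at: "W i (T - 1) = x" using ij child companion by (auto simp: x_def)
    have x_last: "x \<notin> layer s" if "T \<le> s" "s \<le> t + 2 * k" for s
      using ij child_last[OF that] companion_last[OF that] by (auto simp: x_def)
    have x_first: "x \<notin> layer t" unfolding x_def by (rule adjacent_notin(2))
    have x_row: "Suc t \<le> s \<and> s < T \<and> r = i \<and> even (s - Suc t)" if "W r s = x" "t \<le> s" "s \<le> t + 2 * k" for r s
    proof -
      have "s \<noteq> t" using x_first that by auto
      moreover have "\<not> T \<le> s" using x_last[of s] that by auto
      ultimately have s: "Suc t \<le> s" "s < T" using that by auto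
      have "r = i \<and> even (s - Suc t)" by (rule chain) (use s that n_def x_def in auto)
      then show ?thesis using s by simp
    qed
    show False
    proof (rule no_unique_edge[of t "if i = j then t else T - 1" i "{W j t, x}"])
      show "t \<le> (if i = j then t else T - 1)" "(if i = j then t else T - 1) < t + 2 * k"
        using le k_pos by auto
      show "walk_edge W i (if i = j then t else T - 1) = {W j t, x}"
        using ij x_at j' by (auto simp: walk_edge_def x_def Suc_T)
    next
      fix s assume s: "t \<le> s" "s < t + 2 * k"
      show "diag_edge W s \<noteq> {W j t, x}"
      proof
        assume "diag_edge W s = {W j t, x}"
        then consider "W (odd s) s = x" | "W (even s) (Suc s) = x"
          by (auto simp: diag_edge_def doubleton_eq_iff)
        then show False
        proof cases
          case 1
          then show False using x_row[OF 1] s by (auto simp: i_def)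
        next
          case 2
          then show False using x_row[OF 2] s by (auto simp: i_def)
        qed
      qed
    next
      fix r s assume s: "t \<le> s" "s < t + 2 * k" and e: "walk_edge W r s = {W j t, x}"
      consider "W r s = x" "W r (Suc s) = W j t" | "W r (Suc s) = x" "W r s = W j t"
        using e by (auto simp: walk_edge_def doubleton_eq_iff)
      then show "r = i \<and> s = (if i = j then t else T - 1)"
      proof cases
        case 1
        then have "s < T" "r = i" "t < s" using x_row[OF 1(1)] s by auto
        then have "Suc s = T" using no_u[of "Suc s" r] 1(2) by (cases "Suc s < T") auto
        then show ?thesis using 1(2) cross \<open>r = i\<close> by auto
      next
        case 2
        then have "Suc s < T" "r = i" using x_row[OF 2(1)] s by auto
        then have "s = t" using no_u[of s r] 2(2) s by (cases "t < s") auto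
        then show ?thesis using 2(2) \<open>r = i\<close> same_layer by auto
      qed
    qed
  qed
  then show ?case using evn by simp
qed

lemma same_class_same_row:
  assumes "W i s = W j t"
  shows "i = j \<and> (even s \<longleftrightarrow> even t)"
proof -
  have "i = j \<and> (even s \<longleftrightarrow> even t)" if "t \<le> s" "W i s = W j t" for i j s t
  proof -
    have "i = j \<and> even (s - t)"
      by (rule chain_same_row[of "Suc (s - t)"]) (use that next_visit_same_row in auto)
    then show ?thesis using that by auto
  qed
  from this[of t s i j] this[of s t j i] show ?thesis using assms by (cases "t \<le> s") auto
qed

lemma in_layer_iff: "W j t \<in> layer s \<longleftrightarrow> W j s = W j t"
proof
  assume "W j t \<in> layer s"
  then obtain i where i: "W i s = W j t" by (auto simp: layer_iff)
  then show "W j s = W j t" using same_class_same_row[OF i] by simp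
next
  assume "W j s = W j t"
  then show "W j t \<in> layer s" using in_layer[of j s] by simp
qed

text \<open>
  Between two consecutive visits of a vertex the walk explores a subtree that it does not enter again
  within one period. The claim propagates along the excursion: each step either enters a class confined to a
  shorter excursion, or steps back to the class that preceded the first visit of the current one.
\<close>

lemma excursion_separated:
  assumes ret: "next_visit j t T" and s: "t < s" "s < T" and s': "T \<le> s'" "s' \<le> t + 2 * k"
  shows "W j s \<noteq> W j s'"
  using s s'
proof (induction s arbitrary: s' rule: less_induct)
  case (less s)
  show ?case
  proof (cases "s = Suc t")
    case True
    then show ?thesis using next_visit_child(2)[OF ret, of s'] less.prems by (simp add: in_layer_iff)
  next
    case False
    then obtain r where r: "s = Suc r" "t < r" using less.prems by (cases s) auto
    obtain S where S: "next_visit j r S" using next_visit_exists by blast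
    have SW: "W j S = W j r" using next_visit_same_row[OF S] by simp
    have le: "S \<le> r + 2 * k" "Suc (Suc r) \<le> S" using next_visit_le[OF S] next_visit_gap[OF S] by auto
    show ?thesis
    proof (cases "S < T")
      case True
      then show ?thesis using next_visit_child(2)[OF S, of s'] less.prems r by (simp add: in_layer_iff)
    next
      case False
      have "\<not> S \<le> t + 2 * k" using less.IH[of r S] less.prems r False SW by auto
      \<comment> \<open>Here the current class is not met again before the next period, so its next
        visit is one period after its first, and the walk steps back to time \<open>p\<close>.\<close>
      define p where "p = S - 1 - 2 * k"
      have p: "t \<le> p" "p < r" "S - 1 = p + 2 * k"
        using \<open>\<not> S \<le> t + 2 * k\<close> le by (auto simp: p_def)
      have ps: "W j p = W j s"
        using next_visit_child(1)[OF S] p(3) periodic[of j p] by (simp add: in_layer_iff r)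
      have "p \<noteq> t" using ps ret less.prems by (auto simp: next_visit_def in_layer_iff)
      then show ?thesis using less.IH[of p s'] p less.prems r ps by auto
    qed
  qed
qed

text \<open>
  A class met inside an excursion from another class is not met outside of that excursion.
\<close>

lemma noncrossing:
  assumes ord: "t1 < t2" "t2 < t3" "t3 < t4" "t4 \<le> t1 + 2 * k"
    and eq: "W j t1 = W j t3" "W j t2 = W j t4"
  shows "W j t1 = W j t2"
proof (rule ccontr)
  assume ne: "W j t1 \<noteq> W j t2"
  define A where "A = {s \<in> {t1..<t2}. W j s = W j t1}"
  have A: "finite A" "A \<noteq> {}" using ord by (auto simp: A_def)
  define t where "t = Max A"
  have "t \<in> A" unfolding t_def using A by (rule Max_in)
  then have tA: "t1 \<le> t" "t < t2" "W j t = W j t1" by (auto simp: A_def)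
  have max: "W j s \<noteq> W j t1" if "t < s" "s < t2" for s
  proof
    assume "W j s = W j t1"
    then have "s \<in> A" using that tA by (simp add: A_def)
    then have "s \<le> t" unfolding t_def using A by simp
    then show False using that by simp
  qed
  obtain T where T: "next_visit j t T" using next_visit_exists by blast
  have TW: "W j T = W j t1" using next_visit_same_row[OF T] tA by simp
  have "T \<noteq> t2" using TW ne by auto
  moreover have "\<not> T < t2" using max[of T] T TW by (auto simp: next_visit_def)
  ultimately have "t2 < T" by simp
  have "W j t \<in> layer t3" using tA(3) eq(1) in_layer[of j t3] by metis
  then have "T \<le> t3" using T ord(2) tA(2) unfolding next_visit_def by (meson linorder_not_le less_trans)
  then have "T \<le> t4" "t4 \<le> t + 2 * k" using ord tA(1) by linarith+
  then have "W j t2 \<noteq> W j t4" by (rule excursion_separated[OF T tA(2) \<open>t2 < T\<close>])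
  then show False using eq(2) by contradiction
qed

end

section \<open>The interval of noncrossing partitions read off an extremal walk\<close>

text \<open>
  The pairs of points in one block that lie on different sides of the gap between \<open>i\<close> and \<open>i + 1\<close>. Two gaps
  belong to the same block of the Kreweras complement iff they separate the same pairs, so this set is a canonical
  name for that block. Passing to a finer partition only deletes pairs, so equality of these sets is inherited.
\<close>

definition separated_pairs :: "nat \<Rightarrow> (nat \<Rightarrow> nat) \<Rightarrow> nat \<Rightarrow> (nat \<times> nat) set" where
  "separated_pairs k f i = {(x, y). x < k \<and> y < k \<and> f x = f y \<and> (x \<le> i) \<noteq> (y \<le> i)}"

context extremal_walk
begin

definition block_last :: "bool \<Rightarrow> nat \<Rightarrow> nat" where
  "block_last j i = (if i < k then Max {i'. i' < k \<and> W j (2 * i') = W j (2 * i)} else i)"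

lemma block_last_Max:
  assumes "i < k"
  shows "block_last j i < k" "W j (2 * block_last j i) = W j (2 * i)"
    and "i' < k \<Longrightarrow> W j (2 * i') = W j (2 * i) \<Longrightarrow> i' \<le> block_last j i"
proof -
  let ?A = "{i'. i' < k \<and> W j (2 * i') = W j (2 * i)}"
  have A: "finite ?A" "i \<in> ?A" using assms by auto
  then have "Max ?A \<in> ?A" by (intro Max_in) auto
  then show "block_last j i < k" "W j (2 * block_last j i) = W j (2 * i)"
    using assms by (simp_all add: block_last_def)
  show "i' < k \<Longrightarrow> W j (2 * i') = W j (2 * i) \<Longrightarrow> i' \<le> block_last j i"
    using A assms by (simp add: block_last_def)
qed

lemma block_last_ge: "i \<le> block_last j i"
  using block_last_Max(3)[of i i j] by (cases "i < k") (auto simp: block_last_def)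

lemma block_last_eq_iff:
  assumes "i < k" "i' < k"
  shows "block_last j i = block_last j i' \<longleftrightarrow> W j (2 * i) = W j (2 * i')"
proof
  assume "block_last j i = block_last j i'"
  then show "W j (2 * i) = W j (2 * i')"
    using block_last_Max(2)[OF assms(1), of j] block_last_Max(2)[OF assms(2), of j] by simp
next
  assume "W j (2 * i) = W j (2 * i')"
  then show "block_last j i = block_last j i'" using assms by (simp add: block_last_def)
qed

lemma bracketing_block_last: "bracketing 0 k (block_last j)"
  unfolding bracketing_def
proof (intro conjI allI impI)
  fix i i' assume i: "i \<le> i'" "i' \<le> block_last j i"
  show "block_last j i' \<le> block_last j i"
  proof (cases "i < k")
    case False
    then show ?thesis using i by (simp add: block_last_def)
  next
    case True
    note f = block_last_Max[OF True, where j = j]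
    have i'k: "i' < k" using i f(1) by simp
    note f' = block_last_Max[OF i'k, where j = j]
    show ?thesis
    proof (rule ccontr)
      assume less: "\<not> block_last j i' \<le> block_last j i"
      then have ne: "W j (2 * i) \<noteq> W j (2 * i')"
        using block_last_eq_iff[OF True i'k] by (metis order_refl)
      then have "i \<noteq> i'" "i' \<noteq> block_last j i" using f(2) by auto
      then have "W j (2 * i) = W j (2 * i')"
        using i less f(1) f'(1) f(2) f'(2)
        by (intro noncrossing[of "2 * i" "2 * i'" "2 * block_last j i" "2 * block_last j i'"]) auto
      then show False using ne by simp
    qed
  qed
qed (use block_last_Max(1) block_last_ge in \<open>auto simp: block_last_def\<close>)

text \<open>
  Otherwise the \<open>a\<close>-class of \<open>x\<close> and \<open>y\<close> would cross the \<open>b\<close>-class of the gaps \<open>i\<close> and \<open>i'\<close>.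
\<close>

lemma gap_closed:
  assumes i: "i < i'" "i' < k" and eq: "W j (2 * i + 1) = W j (2 * i' + 1)"
    and xy: "y < k" "W j (2 * x) = W j (2 * y)" and x: "i < x" "x \<le> i'"
  shows "i < y \<and> y \<le> i'"
proof (rule ccontr)
  have parity: "W j (2 * m + 1) \<noteq> W j (2 * m')" for m m'
    using same_class_same_row[of j "2 * m + 1" j "2 * m'"] by auto
  assume "\<not> (i < y \<and> y \<le> i')"
  then consider "y \<le> i" | "i' < y" by linarith
  then show False
  proof cases
    case 1
    then have "W j (2 * y) = W j (2 * i + 1)"
      using i eq xy x by (intro noncrossing[of "2 * y" "2 * i + 1" "2 * x" "2 * i' + 1"]) auto
    then show False using parity by metis
  next
    case 2
    then have "W j (2 * i + 1) = W j (2 * x)"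
      using i eq xy x by (intro noncrossing[of "2 * i + 1" "2 * x" "2 * i' + 1" "2 * y"]) auto
    then show False using parity by metis
  qed
qed

lemma gap_class_imp:
  assumes i: "i < i'" "i' < k" and eq: "W j (2 * i + 1) = W j (2 * i' + 1)"
  shows "separated_pairs k (block_last j) i = separated_pairs k (block_last j) i'"
proof -
  have "(x \<le> i) \<noteq> (y \<le> i) \<longleftrightarrow> (x \<le> i') \<noteq> (y \<le> i')"
    if "x < k" "y < k" "block_last j x = block_last j y" for x y
  proof -
    have "W j (2 * x) = W j (2 * y)" using that block_last_eq_iff by simp
    then have "i < x \<and> x \<le> i' \<longleftrightarrow> i < y \<and> y \<le> i'"
      using gap_closed[OF i eq, of x y] gap_closed[OF i eq, of y x] that by auto
    then show ?thesis using i by auto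
  qed
  then show ?thesis unfolding separated_pairs_def by blast
qed

text \<open>
  The class of the gap \<open>i\<close> is next visited right after the last visit to the child entered at the point \<open>i + 1\<close>. If the
  points \<open>i + 1, \<dots>, i'\<close> are a union of blocks, this happens at a gap \<open>m\<close> with \<open>i < m \<le> i'\<close>, which by
  \<open>gap_class_imp\<close> separates the same pairs, and the argument repeats from \<open>m\<close>.
\<close>

lemma gap_class_if:
  assumes i: "i \<le> i'" "i' < k"
    and eq: "separated_pairs k (block_last j) i = separated_pairs k (block_last j) i'"
  shows "W j (2 * i + 1) = W j (2 * i' + 1)"
  using i(1) eq
proof (induction "i' - i" arbitrary: i rule: less_induct)
  case less
  show ?case
  proof (cases "i = i'")
    case True
    then show ?thesis by simp
  next
    case False
    then have ii': "i < i'" using less.prems by simp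
    obtain T where T: "next_visit j (2 * i + 1) T" using next_visit_exists by blast
    have le: "T \<le> 2 * i + 1 + 2 * k" "Suc (Suc (2 * i + 1)) \<le> T"
      using next_visit_le[OF T] next_visit_gap[OF T] by auto
    have TW: "W j T = W j (2 * i + 1)" "even (T - (2 * i + 1))" using next_visit_same_row[OF T] by auto
    then have "odd T" using le by auto
    then obtain m where m: "T = 2 * m + 1" by (rule oddE)
    have im: "i < m" "m \<le> i + k" using le by (auto simp: m)
    have child: "W j (2 * m) = W j (2 * (i + 1))"
      using next_visit_child(1)[OF T] by (simp add: in_layer_iff m)
    \<comment> \<open>The point visited at time \<open>2m\<close>, reduced to the first period.\<close>
    define y where "y = (if m < k then m else m - k)"
    have yk: "y < k" using im ii' i(2) by (auto simp: y_def)
    have "W j (2 * y) = W j (2 * m)"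
      using periodic[of j "2 * (m - k)"] by (auto simp: y_def algebra_simps)
    then have "block_last j y = block_last j (i + 1)"
      using child block_last_eq_iff[OF yk, of "i + 1"] ii' i(2) by simp
    moreover have "(i + 1, y) \<in> separated_pairs k (block_last j) i
        \<longleftrightarrow> (i + 1, y) \<in> separated_pairs k (block_last j) i'"
      using less.prems(2) by simp
    moreover have "i + 1 < k" using ii' i(2) by simp
    ultimately have "y \<le> i \<longleftrightarrow> \<not> y \<le> i'"
      using yk ii' by (simp add: separated_pairs_def)
    then have "i < y" "y \<le> i'" using ii' by auto
    then have my: "m = y" using im by (auto simp: y_def split: if_splits)
    then have mi': "m \<le> i'" "m < k" using \<open>y \<le> i'\<close> yk by auto
    have e: "W j (2 * i + 1) = W j (2 * m + 1)" using TW by (simp add: m)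
    have "separated_pairs k (block_last j) i = separated_pairs k (block_last j) m"
      by (rule gap_class_imp[OF im(1) mi'(2) e])
    then show ?thesis using less.hyps[of m] im mi' e less.prems(2) ii' by simp
  qed
qed

lemma gap_class_iff:
  assumes "i < k" "i' < k"
  shows "W j (2 * i + 1) = W j (2 * i' + 1) \<longleftrightarrow>
    separated_pairs k (block_last j) i = separated_pairs k (block_last j) i'"
proof -
  have *: "W j (2 * i + 1) = W j (2 * i' + 1) \<longleftrightarrow>
    separated_pairs k (block_last j) i = separated_pairs k (block_last j) i'" if "i < i'" "i' < k" for i i'
    using gap_class_imp[OF that] gap_class_if[of i i' j] that by auto
  show ?thesis
    using *[of i i'] *[of i' i] assms by (cases i i' rule: linorder_cases) auto
qed

text \<open>
  Let \<open>S\<close> be the set of \<open>b\<close>-classes of the first row that occur between \<open>t\<close> and \<open>T\<close>; they occur only there. The edges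
  between \<open>S\<close> and \<open>z = W False t\<close> are diagonals, and they lie on the stretch from \<open>t\<close> to \<open>T\<close> of the walk
  formed by the diagonals. Their number is even, so by \<open>even_telescope\<close> this stretch, which starts at \<open>z\<close>,
  also ends at \<open>z\<close>.
\<close>

lemma excursion_preserves_second_row:
  assumes ret: "next_visit True t T" and "even t"
  shows "W False T = W False t"
proof -
  define z where "z = W False t"
  define S where "S = W True ` {s. t < s \<and> s < T \<and> odd s}"
  define d :: "nat \<Rightarrow> nat" where "d s = of_bool (W False s = z)" for s
  have le: "T \<le> t + 2 * k" "t < T" using next_visit_le[OF ret] ret by (auto simp: next_visit_def)
  have "even T" using next_visit_same_row[OF ret] \<open>even t\<close> le by auto
  have finS: "finite S" by (simp add: S_def)
  have S_iff: "W True s \<in> S \<longleftrightarrow> t < s \<and> s < T" if "odd s" "t \<le> s" "s \<le> t + 2 * k" for s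
  proof
    assume "W True s \<in> S"
    then obtain r where r: "t < r" "r < T" "W True r = W True s" by (auto simp: S_def)
    then have "s < T" using excursion_separated[OF ret r(1,2), of s] that by (auto intro: leI)
    moreover have "t \<noteq> s" using that \<open>even t\<close> by auto
    ultimately show "t < s \<and> s < T" using that by simp
  qed (use that in \<open>auto simp: S_def\<close>)
  have z_even: "even s" if "W False s = z" for s
    using same_class_same_row[of False s False t] that \<open>even t\<close> by (simp add: z_def)
  have step: "(\<Sum>x\<in>S. count (step_edges W s) {z, x}) = (if s < T then d s + d (Suc s) else 0)"
    if s: "s \<in> {t..<t + 2 * k}" for s
  proof -
    define w where "w = (if even s then W True (Suc s) else W True s)"
    define y where "y = (if even s then W False s else W False (Suc s))"
    have rows: "W False a \<noteq> W True b" for a b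
      using same_class_same_row[of False a True b] by auto
    have "count (step_edges W s) {z, x} = (if w = x then of_bool (y = z) else 0)" if xS: "x \<in> S" for x
    proof -
      obtain r where x: "x = W True r" using xS unfolding S_def by blast
      have "walk_edge W i s \<noteq> {z, x}" for i
        unfolding walk_edge_def x z_def doubleton_eq_iff using rows by (cases i) metis+
      moreover have "diag_edge W s = {z, x} \<longleftrightarrow> w = x \<and> y = z"
        unfolding diag_edge_def x z_def doubleton_eq_iff w_def y_def using rows by (cases "even s") (simp_all, metis+)
      ultimately show ?thesis by (simp add: step_edges_def)
    qed
    then have "(\<Sum>x\<in>S. count (step_edges W s) {z, x}) = (\<Sum>x\<in>S. if w = x then of_bool (y = z) else 0)"
      by (intro sum.cong) auto
    also have "\<dots> = (if w \<in> S then of_bool (y = z) else 0)" using finS by simp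
    also have "\<dots> = (if s < T then d s + d (Suc s) else 0)"
    proof (cases "even s")
      case True
      have "w \<in> S \<longleftrightarrow> Suc s < T" using S_iff[of "Suc s"] True s by (simp add: w_def)
      moreover have "Suc s < T \<longleftrightarrow> s < T" using True \<open>even T\<close> by (cases "Suc s = T") auto
      moreover have "d (Suc s) = 0" using z_even[of "Suc s"] True by (auto simp: d_def)
      ultimately show ?thesis using True by (simp add: d_def y_def)
    next
      case False
      have "w \<in> S \<longleftrightarrow> s < T" using S_iff[of s] False s \<open>even t\<close> by (cases "s = t") (auto simp: w_def)
      moreover have "d s = 0" using z_even[of s] False by (auto simp: d_def)
      ultimately show ?thesis using False by (simp add: d_def y_def)
    qed
    finally show ?thesis .
  qed
  have "even (\<Sum>x\<in>S. \<Sum>s = t..<t + 2 * k. count (step_edges W s) {z, x})"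
    by (intro dvd_sum even_edges_window)
  also have "(\<Sum>x\<in>S. \<Sum>s = t..<t + 2 * k. count (step_edges W s) {z, x})
     = (\<Sum>s = t..<t + 2 * k. \<Sum>x\<in>S. count (step_edges W s) {z, x})"
    by (rule sum.swap)
  also have "\<dots> = (\<Sum>s = t..<t + 2 * k. if s < T then d s + d (Suc s) else 0)"
    by (intro sum.cong refl step)
  also have "\<dots> = (\<Sum>s = t..<T. d s + d (Suc s))"
    using le by (intro sum.mono_neutral_cong_right) auto
  finally have "even (d t + d T)" using even_telescope[of t T d] le by simp
  then show ?thesis by (auto simp: d_def z_def split: if_splits)
qed

lemma first_row_refines_second:
  assumes "W True (2 * i) = W True (2 * i')"
  shows "W False (2 * i) = W False (2 * i')"
proof -
  have *: "W False t = W False t'" if "even t" "t \<le> t'" "W True t = W True t'" for t t'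
    using that
  proof (induction "t' - t" arbitrary: t rule: less_induct)
    case less
    show ?case
    proof (cases "t = t'")
      case False
      obtain T where T: "next_visit True t T" using next_visit_exists by blast
      have Tt: "t < T" "W True T = W True t" "even T"
        using next_visit_same_row[OF T] less.prems T by (auto simp: next_visit_def)
      have "T \<le> t'"
      proof (rule leI, rule notI)
        assume "t' < T"
        moreover have "t < t'" using less.prems False by simp
        ultimately have "W True t \<notin> layer t'" using T unfolding next_visit_def by blast
        then show False using less.prems(3) by (simp add: in_layer_iff)
      qed
      then have "W False T = W False t'" using less.hyps[of T] less.prems Tt by auto
      then show ?thesis using excursion_preserves_second_row[OF T] less.prems by simp
    qed simp
  qed
  show ?thesis
  proof (cases "i \<le> i'")
    case True
    then show ?thesis by (intro * assms) simp_all
  next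
    case False
    then have "W False (2 * i') = W False (2 * i)" by (intro * assms[symmetric]) simp_all
    then show ?thesis by simp
  qed
qed

lemma block_last_interval: "(block_last True, block_last False) \<in> nc_intervals 0 k"
proof -
  have "block_last False (block_last True i) = block_last False i" for i
  proof (cases "i < k")
    case True
    note f = block_last_Max[OF True, where j = True]
    show ?thesis
      using first_row_refines_second[OF f(2)] block_last_eq_iff[OF f(1) True, of False] by simp
  next
    case False
    then show ?thesis by (simp add: block_last_def)
  qed
  then show ?thesis by (simp add: nc_intervals_def bracketing_block_last)
qed

end

section \<open>The walk of an interval of noncrossing partitions\<close>

text \<open>
  Canonical names for the classes of one row: the last point of an \<open>a\<close>-block, and the set of
  separated pairs for a block of the Kreweras complement.
\<close>

definition row_label :: "nat \<Rightarrow> (nat \<Rightarrow> nat) \<Rightarrow> nat \<Rightarrow> nat + (nat \<times> nat) set" where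
  "row_label k h t = (let i = t mod (2 * k) div 2 in
     if even t then Inl (h i) else Inr (separated_pairs k h i))"

lemma row_label_even: "row_label k h (2 * i) = Inl (h (i mod k))"
  by (simp add: row_label_def)

lemma row_label_odd: "i < k \<Longrightarrow> row_label k h (2 * i + 1) = Inr (separated_pairs k h i)"
  by (simp add: row_label_def)

text \<open>
  The cyclic successor of a point in its block.
\<close>

definition block_succ :: "(nat \<Rightarrow> nat) \<Rightarrow> nat \<Rightarrow> nat" where
  "block_succ h i = (if i < h i then LEAST j. i < j \<and> h j = h i else LEAST j. h j = h i)"

context
  fixes k :: nat and h :: "nat \<Rightarrow> nat"
  assumes h: "bracketing 0 k h"
begin

lemma block_succ_ascent:
  assumes "i < h i"
  shows "i < block_succ h i" "h (block_succ h i) = h i" "block_succ h i \<le> h i"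
    and "i < m \<Longrightarrow> m < block_succ h i \<Longrightarrow> h m \<noteq> h i"
proof -
  have ex: "i < h i \<and> h (h i) = h i" using assms bracketing_idem[OF h] by simp
  have eq: "block_succ h i = (LEAST j. i < j \<and> h j = h i)" using assms by (simp add: block_succ_def)
  show "i < block_succ h i" "h (block_succ h i) = h i"
    unfolding eq using LeastI[of "\<lambda>j. i < j \<and> h j = h i", OF ex] by auto
  show "block_succ h i \<le> h i" unfolding eq using ex by (rule Least_le)
  show "i < m \<Longrightarrow> m < block_succ h i \<Longrightarrow> h m \<noteq> h i"
    unfolding eq using not_less_Least[of m "\<lambda>j. i < j \<and> h j = h i"] by auto
qed

lemma block_succ_last:
  assumes "h i = i"
  shows "block_succ h i \<le> i" "h (block_succ h i) = i"
    and "m < block_succ h i \<Longrightarrow> h m \<noteq> i"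
proof -
  have eq: "block_succ h i = (LEAST j. h j = i)" using assms by (simp add: block_succ_def)
  show "block_succ h i \<le> i" unfolding eq using assms by (rule Least_le)
  show "h (block_succ h i) = i" unfolding eq using assms by (rule LeastI)
  show "m < block_succ h i \<Longrightarrow> h m \<noteq> i"
    unfolding eq using not_less_Least[of m "\<lambda>j. h j = i"] by auto
qed

lemma last_cases: "i < h i \<or> h i = i"
  using bracketing_le[OF h, of i] by linarith

lemma block_succ_same_block: "h (block_succ h i) = h i"
  using block_succ_ascent(2)[of i] block_succ_last(2)[of i] last_cases[of i] by auto

lemma block_succ_less: "i < k \<Longrightarrow> block_succ h i < k"
  using block_succ_ascent(3)[of i] block_succ_last(1)[of i] last_cases[of i] bracketing_less[OF h, of i]
  by fastforce

lemma inj_block_succ: "inj_on (block_succ h) A"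
proof (rule inj_onI)
  have *: False if "i < i'" and eq: "block_succ h i = block_succ h i'" for i i'
  proof -
    have blk: "h i = h i'" using block_succ_same_block[of i] block_succ_same_block[of i'] eq by simp
    consider "i < h i" "i' < h i'" | "i < h i" "h i' = i'" | "h i = i"
      using last_cases by auto
    then show False
    proof cases
      case 1
      then show False using block_succ_ascent(4)[OF 1(1), of i'] block_succ_ascent(1)[OF 1(2)] that blk by simp
    next
      case 2
      have "\<not> i < block_succ h i'" using block_succ_last(3)[OF 2(2), of i] blk 2(2) by auto
      then show False using block_succ_ascent(1)[OF 2(1)] eq by simp
    next
      case 3
      then show False using blk that(1) bracketing_le[OF h, of i'] by simp
    qed
  qed
  fix i i' assume "block_succ h i = block_succ h i'"
  then show "i = i'" using *[of i i'] *[of i' i] by (cases i i' rule: linorder_cases) auto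
qed

lemma separated_pairs_eqI:
  assumes "i \<le> i'"
    and "\<And>x y. y < k \<Longrightarrow> h x = h y \<Longrightarrow> i < x \<Longrightarrow> x \<le> i' \<Longrightarrow> i < y \<and> y \<le> i'"
  shows "separated_pairs k h i = separated_pairs k h i'"
proof -
  have "(x \<le> i) \<noteq> (y \<le> i) \<longleftrightarrow> (x \<le> i') \<noteq> (y \<le> i')" if "x < k" "y < k" "h x = h y" for x y
  proof -
    have "i < x \<and> x \<le> i' \<longleftrightarrow> i < y \<and> y \<le> i'"
      using assms(2)[of x y] assms(2)[of y x] that by auto
    then show ?thesis using assms(1) by auto
  qed
  then show ?thesis unfolding separated_pairs_def by blast
qed

text \<open>
  The points after \<open>i\<close> and before its successor form a union of blocks, as do those from the first to the last point
  of a block. Hence the gap just before the successor lies in the same block of the Kreweras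
  complement as the gap just after \<open>i\<close>. The index is taken modulo \<open>k\<close> because the gap before the
  point \<open>0\<close> is \<open>k - 1\<close>.
\<close>

lemma separated_pairs_before_succ:
  assumes "i < k"
  shows "separated_pairs k h ((block_succ h i + k - 1) mod k) = separated_pairs k h i"
proof -
  let ?j = "block_succ h i"
  have jk: "?j < k" using assms by (rule block_succ_less)
  consider "i < h i" | "h i = i" "0 < ?j" | "h i = i" "?j = 0" using last_cases[of i] by auto
  then show ?thesis
  proof cases
    case 1
    note s = block_succ_ascent[OF 1]
    have "?j + k - 1 = (?j - 1) + k" using s(1) by simp
    then have mod: "(?j + k - 1) mod k = ?j - 1" using jk by (metis mod_add_self2 mod_less less_imp_diff_less)
    have "separated_pairs k h i = separated_pairs k h (?j - 1)"
    proof (rule separated_pairs_eqI)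
      show "i \<le> ?j - 1" using s(1) by simp
      fix x y assume xy: "h x = h y" "i < x" "x \<le> ?j - 1"
      have x: "x < ?j" "h x \<noteq> h i" using s(1) s(4)[of x] xy by auto
      have "h x \<le> h i" using bracketing_nested[OF h, of i x] xy(2) x(1) s(3) by simp
      show "i < y \<and> y \<le> ?j - 1"
      proof (rule ccontr)
        assume "\<not> (i < y \<and> y \<le> ?j - 1)"
        then consider "y \<le> i" | "?j \<le> y" using s(1) by linarith
        then have "h i \<le> h x"
        proof cases
          case 1
          then show ?thesis
            using bracketing_nested[OF h, of y i] bracketing_le[OF h, of x] xy by simp
        next
          case 2
          then show ?thesis
            using bracketing_nested[OF h, of x ?j] bracketing_le[OF h, of y] xy x s(2) by simp
        qed
        then show False using \<open>h x \<le> h i\<close> x(2) by simp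
      qed
    qed
    then show ?thesis unfolding mod by simp
  next
    case 2
    note s = block_succ_last[OF 2(1)]
    have "?j + k - 1 = (?j - 1) + k" using 2(2) by simp
    then have mod: "(?j + k - 1) mod k = ?j - 1" using jk by (metis mod_add_self2 mod_less less_imp_diff_less)
    have "separated_pairs k h (?j - 1) = separated_pairs k h i"
    proof (rule separated_pairs_eqI)
      show "?j - 1 \<le> i" using s(1) by simp
      fix x y assume xy: "h x = h y" "?j - 1 < x" "x \<le> i"
      have "h x \<le> i" using bracketing_nested[OF h, of ?j x] xy s(2) 2(2) by simp
      moreover have "\<not> y < ?j"
      proof
        assume "y < ?j"
        then have "h ?j \<le> h y" using bracketing_nested[OF h, of y ?j] bracketing_le[OF h, of x] xy by simp
        then have "h y = i" using s(2) \<open>h x \<le> i\<close> xy by simp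
        then show False using s(3)[of y] \<open>y < ?j\<close> by simp
      qed
      ultimately show "?j - 1 < y \<and> y \<le> i" using bracketing_le[OF h, of y] xy(1) 2(2) by simp
    qed
    then show ?thesis unfolding mod by simp
  next
    case 3
    have h0: "h 0 = i" using block_succ_last(2)[OF 3(1)] 3(2) by simp
    have mod: "(?j + k - 1) mod k = k - 1" using 3(2) assms by simp
    have "separated_pairs k h i = separated_pairs k h (k - 1)"
    proof (rule separated_pairs_eqI)
      show "i \<le> k - 1" using assms by simp
      fix x y assume xy: "y < k" "h x = h y" "i < x"
      have "\<not> y \<le> i"
        using bracketing_nested[OF h, of 0 y] bracketing_le[OF h, of x] h0 xy by auto
      then show "i < y \<and> y \<le> k - 1" using xy by simp
    qed
    then show ?thesis unfolding mod by simp
  qed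
qed

text \<open>
  The step from the point \<open>i\<close> to its gap is undone by the step from the gap before the successor of
  \<open>i\<close> to that successor, and taking successors is a permutation.
\<close>

lemma row_edges_paired:
  assumes k: "0 < k"
  shows "\<exists>N. (\<Sum>t<2 * k. {#{row_label k h t, row_label k h (Suc t)}#}) = N + N"
proof -
  define up where "up i = {Inl (h i), Inr (separated_pairs k h i)}" for i
  define down where "down i = {Inr (separated_pairs k h i), Inl (h (Suc i mod k))}" for i
  define \<rho> where "\<rho> i = (block_succ h i + k - 1) mod k" for i
  have Suc_\<rho>: "Suc (\<rho> i) mod k = block_succ h i" if "i < k" for i
  proof -
    have "Suc (\<rho> i) mod k = Suc (block_succ h i + k - 1) mod k"
      unfolding \<rho>_def by (rule mod_Suc_eq)
    also have "Suc (block_succ h i + k - 1) = block_succ h i + k" using k by simp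
    finally show ?thesis using block_succ_less[OF that] by simp
  qed
  have "inj_on \<rho> {..<k}"
  proof (rule inj_onI)
    fix i i' assume "i \<in> {..<k}" "i' \<in> {..<k}" "\<rho> i = \<rho> i'"
    then have "block_succ h i = block_succ h i'" using Suc_\<rho>[of i] Suc_\<rho>[of i'] by simp
    then show "i = i'" using inj_block_succ[of UNIV] by (simp add: inj_on_def)
  qed
  moreover have "\<rho> ` {..<k} \<subseteq> {..<k}" using k by (auto simp: \<rho>_def)
  ultimately have bij: "bij_betw \<rho> {..<k} {..<k}"
    by (simp add: bij_betw_def endo_inj_surj)
  have down_\<rho>: "down (\<rho> i) = up i" if "i < k" for i
  proof -
    have "separated_pairs k h (\<rho> i) = separated_pairs k h i"
      unfolding \<rho>_def using that by (rule separated_pairs_before_succ)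
    moreover have "h (Suc (\<rho> i) mod k) = h i" using Suc_\<rho>[OF that] block_succ_same_block by simp
    ultimately show ?thesis by (auto simp: down_def up_def)
  qed
  have "(\<Sum>t<2 * k. {#{row_label k h t, row_label k h (Suc t)}#})
    = (\<Sum>i<k. {#{row_label k h (2 * i), row_label k h (2 * i + 1)}#}
      + {#{row_label k h (2 * i + 1), row_label k h (2 * (i + 1))}#})"
    by (simp add: sum_double)
  also have "\<dots> = (\<Sum>i<k. {#up i#} + {#down i#})"
    by (intro sum.cong refl) (simp only: row_label_even row_label_odd lessThan_iff up_def down_def mod_less Suc_eq_plus1)
  also have "\<dots> = (\<Sum>i<k. {#up i#}) + (\<Sum>i<k. {#down i#})" by (rule sum.distrib)
  also have "(\<Sum>i<k. {#down i#}) = (\<Sum>i<k. {#down (\<rho> i)#})"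
    by (rule sum.reindex_bij_betw[OF bij, symmetric])
  also have "\<dots> = (\<Sum>i<k. {#up i#})" by (intro sum.cong refl) (simp add: down_\<rho>)
  finally show ?thesis by blast
qed

text \<open>
  The blocks of a noncrossing partition and of its Kreweras complement number \<open>k + 1\<close> together. For the lower bound,
  the blocks correspond to their last points; each of the other points is followed by a gap that starts
  a new block of the complement, and the gap \<open>k - 1\<close>, which separates no pairs, gives one more.
\<close>

lemma card_row_labels:
  assumes k: "0 < k"
  shows "k + 1 \<le> card (row_label k h ` {..<2 * k})"
proof -
  define A where "A = {i. i < k \<and> h i = i}"
  define B where "B = {i. i < k \<and> i < h i}"
  have AB: "finite A" "finite B" "A \<inter> B = {}" "A \<union> B = {..<k}"
    using last_cases by (auto simp: A_def B_def)
  then have kAB: "k = card A + card B" by (metis card_Un_disjoint card_lessThan)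
  have last: "h (k - 1) = k - 1"
    using bracketing_le[OF h, of "k - 1"] bracketing_less[OF h, of "k - 1"] k by linarith
  have inj: "inj_on (separated_pairs k h) (insert (k - 1) B)"
  proof (rule inj_onI)
    have *: False if i: "i < i'" "i' < k" "i < h i" and eq: "separated_pairs k h i = separated_pairs k h i'"
      and i': "i' < h i' \<or> i' = k - 1" for i i'
    proof -
      have hk: "h m < k" if "m < k" for m using bracketing_less[OF h that] .
      have "(i, h i) \<in> separated_pairs k h i"
        using i hk bracketing_idem[OF h] by (simp add: separated_pairs_def)
      then have "i' < h i" using i(1) unfolding eq by (auto simp: separated_pairs_def)
      then have "i' < h i'" using i' hk[of i] i by linarith
      then have "(i', h i') \<in> separated_pairs k h i'"
        using i hk bracketing_idem[OF h] by (simp add: separated_pairs_def)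
      then show False using i(1) \<open>i' < h i'\<close> unfolding eq[symmetric] by (auto simp: separated_pairs_def)
    qed
    fix i i' assume m: "i \<in> insert (k - 1) B" "i' \<in> insert (k - 1) B"
      and eq: "separated_pairs k h i = separated_pairs k h i'"
    show "i = i'"
      using *[of i i'] *[of i' i] m eq k by (cases i i' rule: linorder_cases) (auto simp: B_def)
  qed
  have sub: "Inl ` A \<union> Inr ` separated_pairs k h ` insert (k - 1) B \<subseteq> row_label k h ` {..<2 * k}"
  proof (intro Un_least subsetI)
    fix x :: "nat + (nat \<times> nat) set" assume "x \<in> Inl ` A"
    then obtain i where "x = Inl i" "i < k" "h i = i" by (auto simp: A_def)
    then show "x \<in> row_label k h ` {..<2 * k}"
      using row_label_even[of k h i] by (intro image_eqI[of _ _ "2 * i"]) auto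
  next
    fix x :: "nat + (nat \<times> nat) set" assume "x \<in> Inr ` separated_pairs k h ` insert (k - 1) B"
    then obtain i where "x = Inr (separated_pairs k h i)" "i < k" using k by (auto simp: B_def)
    then show "x \<in> row_label k h ` {..<2 * k}"
      using row_label_odd[of i k h] by (intro image_eqI[of _ _ "2 * i + 1"]) auto
  qed
  have "k - 1 \<notin> B" using last by (auto simp: B_def)
  then have "k + 1 = card A + card (insert (k - 1) B)" using kAB AB by simp
  also have "\<dots> = card ((Inl :: nat \<Rightarrow> nat + (nat \<times> nat) set) ` A) + card ((Inr :: _ \<Rightarrow> nat + (nat \<times> nat) set) ` separated_pairs k h ` insert (k - 1) B)"
    using card_image[OF inj] by (simp only: card_image[OF inj_Inl] card_image[OF inj_Inr])
  also have "\<dots> = card (Inl ` A \<union> Inr ` separated_pairs k h ` insert (k - 1) B)"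
    using AB by (intro card_Un_disjoint[symmetric]) auto
  also have "\<dots> \<le> card (row_label k h ` {..<2 * k})"
    using sub by (intro card_mono) auto
  finally show ?thesis .
qed

end

definition interval_walk ::
  "nat \<Rightarrow> (nat \<Rightarrow> nat) \<Rightarrow> (nat \<Rightarrow> nat) \<Rightarrow> bool \<Rightarrow> nat \<Rightarrow> bool \<times> (nat + (nat \<times> nat) set)" where
  "interval_walk k f g j t = (j, row_label k (if j then f else g) t)"

text \<open>
  Each row is even by \<open>row_edges_paired\<close>. Since \<open>f\<close> refines \<open>g\<close>, the pairs separated for \<open>f\<close> can be recovered
  from those separated for \<open>g\<close>. So the diagonal edges are the image of the edges of the
  second row under a map of vertices, and evenness is inherited.
\<close>

lemma interval_walk_even_edges:
  assumes fg: "(f, g) \<in> nc_intervals 0 k" and k: "0 < k"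
  shows "\<exists>N. (\<Sum>t<2 * k. step_edges (interval_walk k f g) t) = N + N"
proof -
  let ?W = "interval_walk k f g"
  define coarsen where "coarsen = (\<lambda>(j :: bool, l :: nat + (nat \<times> nat) set).
    case l of Inl a \<Rightarrow> (False, Inl a) | Inr s \<Rightarrow> (True, Inr {(x, y) \<in> s. f x = f y}))"
  have f: "bracketing 0 k f" and g: "bracketing 0 k g" and gf: "\<And>i. g (f i) = g i"
    using fg by (auto simp: nc_intervals_def)
  have refine: "g x = g y" if "f x = f y" for x y using gf[of x] gf[of y] that by simp
  have row: "walk_edge ?W j t = Pair j ` {row_label k (if j then f else g) t, row_label k (if j then f else g) (Suc t)}" for j t
    by (simp add: walk_edge_def interval_walk_def)
  have sep: "{(x, y) \<in> separated_pairs k g i. f x = f y} = separated_pairs k f i" for i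
  proof (rule set_eqI)
    fix p
    show "p \<in> {(x, y) \<in> separated_pairs k g i. f x = f y} \<longleftrightarrow> p \<in> separated_pairs k f i"
      using refine[of "fst p" "snd p"] by (cases p) (auto simp: separated_pairs_def)
  qed
  have "coarsen (?W False t) = ?W (odd t) t" for t
    by (simp add: coarsen_def interval_walk_def row_label_def Let_def sep)
  then have diag: "diag_edge ?W t = coarsen ` walk_edge ?W False t" for t
    by (simp add: diag_edge_def walk_edge_def)
  obtain N1 where N1: "(\<Sum>t<2 * k. {#{row_label k f t, row_label k f (Suc t)}#}) = N1 + N1"
    using row_edges_paired[OF f k] by blast
  obtain N2 where N2: "(\<Sum>t<2 * k. {#{row_label k g t, row_label k g (Suc t)}#}) = N2 + N2"
    using row_edges_paired[OF g k] by blast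
  have "(\<Sum>t<2 * k. step_edges ?W t)
    = (\<Sum>t<2 * k. {#walk_edge ?W True t#}) + (\<Sum>t<2 * k. {#walk_edge ?W False t#})
      + (\<Sum>t<2 * k. {#diag_edge ?W t#})"
    by (simp add: step_edges_def add_mset_commute flip: sum.distrib)
  also have "(\<Sum>t<2 * k. {#walk_edge ?W True t#}) = image_mset (image (Pair True)) (N1 + N1)"
    unfolding N1[symmetric] image_mset_sum_lessThan row by simp
  also have "(\<Sum>t<2 * k. {#diag_edge ?W t#}) = image_mset (image coarsen) (\<Sum>t<2 * k. {#walk_edge ?W False t#})"
    unfolding image_mset_sum_lessThan diag by simp
  also have "(\<Sum>t<2 * k. {#walk_edge ?W False t#}) = image_mset (image (Pair False)) (N2 + N2)"
    unfolding N2[symmetric] image_mset_sum_lessThan row by simp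
  finally have "(\<Sum>t<2 * k. step_edges ?W t) =
     (image_mset (image (Pair True)) N1 + image_mset (image (Pair False)) N2
       + image_mset (image coarsen) (image_mset (image (Pair False)) N2)) +
     (image_mset (image (Pair True)) N1 + image_mset (image (Pair False)) N2
       + image_mset (image coarsen) (image_mset (image (Pair False)) N2))"
    by (simp add: add_ac)
  then show ?thesis by blast
qed

lemma card_interval_walk:
  assumes fg: "(f, g) \<in> nc_intervals 0 k" and k: "0 < k"
  shows "2 * k + 2 \<le> card (\<Union>t<2 * k. range (\<lambda>j. interval_walk k f g j t))" (is "_ \<le> card ?U")
proof -
  have f: "bracketing 0 k f" and g: "bracketing 0 k g"
    using fg by (auto simp: nc_intervals_def)
  have U: "?U = Pair True ` row_label k f ` {..<2 * k} \<union> Pair False ` row_label k g ` {..<2 * k}"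
    unfolding interval_walk_def UNIV_bool by auto
  have "card ?U = card (Pair True ` row_label k f ` {..<2 * k}) + card (Pair False ` row_label k g ` {..<2 * k})"
    unfolding U by (rule card_Un_disjoint) auto
  also have "\<dots> = card (row_label k f ` {..<2 * k}) + card (row_label k g ` {..<2 * k})"
    by (simp add: card_image inj_on_def)
  finally show ?thesis using card_row_labels[OF f k] card_row_labels[OF g k] by simp
qed

section \<open>Forests and the equivalence relations they induce\<close>

lemma linked_refl: "linked C u u"
  unfolding linked_def is_path_def by (intro exI[of _ "[u]"]) simp

lemma linked_step:
  assumes "linked C u v" "{v, w} \<in> C"
  shows "linked C u w"
proof -
  obtain p where p: "p \<noteq> []" "distinct p" "successively (\<lambda>x y. {x, y} \<in> C) p" "hd p = u" "last p = v"
    using assms(1) by (auto simp: linked_def is_path_def)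
  show ?thesis
  proof (cases "w \<in> set p")
    case False
    then have "is_path C (p @ [w])"
      using p assms(2) by (auto simp: is_path_def successively_append_iff)
    then show ?thesis using p unfolding linked_def by (intro exI[of _ "p @ [w]"]) simp
  next
    case True
    then obtain p1 p2 where p12: "p = p1 @ w # p2" by (meson split_list)
    then have "is_path C (p1 @ [w])"
      using p by (auto simp: is_path_def successively_append_iff)
    then show ?thesis using p p12 unfolding linked_def
      by (intro exI[of _ "p1 @ [w]"]) (cases p1; simp)
  qed
qed

lemma linked_iff_rtrancl: "linked C u v \<longleftrightarrow> (u, v) \<in> {(x, y). {x, y} \<in> C}\<^sup>*"
proof
  have "(hd p, last p) \<in> {(x, y). {x, y} \<in> C}\<^sup>*"
    if "p \<noteq> []" "successively (\<lambda>x y. {x, y} \<in> C) p" for p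
    using that
  proof (induction p)
    case (Cons x p)
    then show ?case by (cases p) (auto intro: converse_rtrancl_into_rtrancl)
  qed simp
  then show "linked C u v \<Longrightarrow> (u, v) \<in> {(x, y). {x, y} \<in> C}\<^sup>*"
    by (auto simp: linked_def is_path_def)
next
  assume "(u, v) \<in> {(x, y). {x, y} \<in> C}\<^sup>*"
  then show "linked C u v"
    by (induction rule: rtrancl_induct) (auto intro: linked_refl linked_step)
qed

lemma linked_trans: "linked C u v \<Longrightarrow> linked C v w \<Longrightarrow> linked C u w"
  unfolding linked_iff_rtrancl by (rule rtrancl_trans)

lemma linked_sym: "linked C u v \<Longrightarrow> linked C v u"
proof -
  have "sym ({(x, y). {x, y} \<in> C}\<^sup>*)"
    by (intro sym_rtrancl symI) (auto simp: insert_commute)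
  then show "linked C u v \<Longrightarrow> linked C v u"
    unfolding linked_iff_rtrancl by (rule symD)
qed

lemma linked_edge: "{u, v} \<in> C \<Longrightarrow> linked C u v"
  using linked_step[OF linked_refl] .

lemma linked_mono: "C \<subseteq> C' \<Longrightarrow> linked C u v \<Longrightarrow> linked C' u v"
  unfolding linked_iff_rtrancl by (rule rtrancl_mono[THEN subsetD]) auto

lemma linked_invariant:
  assumes "\<And>x y. {x, y} \<in> C \<Longrightarrow> h x = h y" and "linked C u v"
  shows "h u = h v"
  using assms(2) unfolding linked_iff_rtrancl
  by (induction rule: rtrancl_induct) (auto dest: assms(1))

lemma linked_insert:
  "linked (insert {x, y} C) u v \<longleftrightarrow>
     linked C u v \<or> linked C u x \<and> linked C y v \<or> linked C u y \<and> linked C x v"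
proof
  assume "linked (insert {x, y} C) u v"
  then show "linked C u v \<or> linked C u x \<and> linked C y v \<or> linked C u y \<and> linked C x v"
    unfolding linked_iff_rtrancl[of "insert {x, y} C"]
  proof (induction rule: rtrancl_induct)
    case base
    then show ?case by (simp add: linked_refl)
  next
    case (step v w)
    then consider "{v, w} \<in> C" | "v = x" "w = y" | "v = y" "w = x"
      by (auto simp: doubleton_eq_iff)
    then show ?case using step.IH
      by cases (blast intro: linked_step linked_refl linked_trans linked_sym)+
  qed
next
  assume "linked C u v \<or> linked C u x \<and> linked C y v \<or> linked C u y \<and> linked C x v"
  moreover have "linked (insert {x, y} C) x y" by (rule linked_edge) simp
  ultimately show "linked (insert {x, y} C) u v"
    by (meson linked_mono linked_trans linked_sym subset_insertI)
qed

definition components :: "'a set \<Rightarrow> 'a set set \<Rightarrow> 'a set set" where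
  "components V C = (\<lambda>u. {v \<in> V. linked C u v}) ` V"

lemma component_eq_iff:
  assumes "v \<in> V"
  shows "{w \<in> V. linked C u w} = {w \<in> V. linked C v w} \<longleftrightarrow> linked C u v"
proof
  assume "{w \<in> V. linked C u w} = {w \<in> V. linked C v w}"
  moreover have "v \<in> {w \<in> V. linked C v w}" using assms by (simp add: linked_refl)
  ultimately show "linked C u v" by blast
next
  assume "linked C u v"
  then show "{w \<in> V. linked C u w} = {w \<in> V. linked C v w}"
    by (blast intro: linked_trans linked_sym)
qed

lemma acyclic_edge_not_linked:
  assumes "\<nexists>p. is_cycle (insert {x, y} C) p" "{x, y} \<notin> C" "x \<noteq> y"
  shows "\<not> linked C x y"
proof
  assume "linked C x y"
  then obtain p where p: "is_path C p" "hd p = x" "last p = y" by (auto simp: linked_def)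
  have "length p \<ge> 3"
  proof (rule ccontr)
    assume "\<not> 3 \<le> length p"
    then consider "p = []" | a where "p = [a]" | a b where "p = [a, b]"
      by (cases p rule: remdups_adj.cases) (auto simp: not_le numeral_3_eq_3 less_Suc_eq_le)
    then show False using p assms(2,3) by cases (auto simp: is_path_def)
  qed
  moreover have "is_path (insert {x, y} C) p"
    using p(1) unfolding is_path_def by (auto elim: successively_mono)
  ultimately have "is_cycle (insert {x, y} C) p"
    using p by (auto simp: is_cycle_def insert_commute)
  then show False using assms(1) by blast
qed

lemma is_cycle_mono: "C \<subseteq> C' \<Longrightarrow> is_cycle C p \<Longrightarrow> is_cycle C' p"
  unfolding is_cycle_def is_path_def by (auto elim: successively_mono)

text \<open>
  By \<open>acyclic_edge_not_linked\<close> every further edge of a forest joins two different components.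
\<close>

lemma card_forest:
  assumes V: "finite V" and C: "C \<in> constraint_graphs V"
  shows "card C + card (components V C) = card V"
proof -
  have "C \<subseteq> Pow V" using C by (auto simp: constraint_graphs_def)
  then have "finite C" using V by (meson finite_Pow_iff finite_subset)
  then show ?thesis using C
  proof (induction C rule: finite_induct)
    case empty
    have "linked ({} :: 'a set set) u v \<longleftrightarrow> u = v" for u v
      unfolding linked_iff_rtrancl by simp
    then have "components V {} = (\<lambda>u. {u}) ` V" by (auto simp: components_def)
    then show ?case by (simp add: card_image)
  next
    case (insert e C)
    have e: "e \<subseteq> V" "card e = 2" and acyc: "\<nexists>p. is_cycle (insert e C) p"
      using insert.prems by (auto simp: constraint_graphs_def)
    obtain x y where xy: "e = {x, y}" "x \<noteq> y" using e(2) by (auto simp: card_2_iff)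
    have C: "C \<in> constraint_graphs V"
      using insert.prems is_cycle_mono[OF subset_insertI[of C e]] by (auto simp: constraint_graphs_def)
    have not: "\<not> linked C x y"
      using acyclic_edge_not_linked acyc insert.hyps(2) xy by metis
    have xyV: "x \<in> V" "y \<in> V" using e(1) xy by auto
    define comp where "comp u = {w \<in> V. linked C u w}" for u
    have comps: "components V C = comp ` V" by (simp add: components_def comp_def)
    have comp_iff: "comp u = comp v \<longleftrightarrow> linked C u v" if "v \<in> V" for u v
      unfolding comp_def using that by (rule component_eq_iff)
    have new: "{w \<in> V. linked (insert e C) u w} = (if linked C u x \<or> linked C u y then comp x \<union> comp y else comp u)" for u
      unfolding xy(1) linked_insert comp_def
      by (auto intro: linked_trans linked_sym)
    have "components V (insert e C) = insert (comp x \<union> comp y) (comp ` V - {comp x, comp y})"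
    proof (intro equalityI subsetI)
      fix A assume "A \<in> components V (insert e C)"
      then obtain u where u: "u \<in> V" "A = (if linked C u x \<or> linked C u y then comp x \<union> comp y else comp u)"
        by (auto simp: components_def new)
      then show "A \<in> insert (comp x \<union> comp y) (comp ` V - {comp x, comp y})"
        using comp_iff[OF xyV(1), of u] comp_iff[OF xyV(2), of u] by auto
    next
      fix A assume A: "A \<in> insert (comp x \<union> comp y) (comp ` V - {comp x, comp y})"
      show "A \<in> components V (insert e C)"
      proof (cases "A = comp x \<union> comp y")
        case True
        then show ?thesis unfolding components_def new
          by (intro image_eqI[of _ _ x]) (auto simp: xyV linked_refl)
      next
        case False
        then obtain u where u: "u \<in> V" "A = comp u" "comp u \<noteq> comp x" "comp u \<noteq> comp y" using A by auto
        then show ?thesis unfolding components_def new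
          using comp_iff[OF xyV(1), of u] comp_iff[OF xyV(2), of u]
          by (intro image_eqI[of _ _ u]) auto
      qed
    qed
    moreover have "comp x \<union> comp y \<notin> comp ` V - {comp x, comp y}"
    proof
      assume "comp x \<union> comp y \<in> comp ` V - {comp x, comp y}"
      then obtain u where u: "u \<in> V" "comp u = comp x \<union> comp y" "comp u \<noteq> comp x" by auto
      have "x \<in> comp u" unfolding u(2) using xyV by (simp add: comp_def linked_refl)
      then have "linked C u x" by (simp add: comp_def)
      then show False using comp_iff[OF xyV(1), of u] u(3) by simp
    qed
    moreover have "finite (comp ` V)" using V by simp
    moreover have "card (comp ` V - {comp x, comp y}) = card (comp ` V) - 2"
      using comp_iff[OF xyV(2), of x] not xyV by (subst card_Diff_subset) auto
    moreover have "2 \<le> card (comp ` V)"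
    proof -
      have "card {comp x, comp y} \<le> card (comp ` V)" using V xyV by (intro card_mono) auto
      then show ?thesis using comp_iff[OF xyV(2), of x] not by simp
    qed
    ultimately have "Suc (card (components V (insert e C))) = card (components V C)"
      by (simp add: comps)
    then show ?case using insert.IH[OF C] insert.hyps by simp
  qed
qed

text \<open>
  Each class is spanned by a star centred at a chosen representative. There are no cycles because every
  edge contains the representative of its class, whereas no vertex lies on all edges of a cycle.
\<close>

lemma forest_with_given_classes:
  fixes l :: "'a \<Rightarrow> 'b"
  shows "\<exists>C \<in> constraint_graphs V. \<forall>u\<in>V. \<forall>v\<in>V. linked C u v \<longleftrightarrow> l u = l v"
proof -
  define r where "r v = (SOME w. w \<in> V \<and> l w = l v)" for v
  have r: "r v \<in> V \<and> l (r v) = l v" if "v \<in> V" for v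
    unfolding r_def using someI[of "\<lambda>w. w \<in> V \<and> l w = l v" v] that by simp
  have r_cong: "r u = r v" if "l u = l v" for u v
    using that by (simp add: r_def)
  define C where "C = {{r v, v} | v. v \<in> V \<and> r v \<noteq> v}"
  have edge: "x \<in> V \<and> y \<in> V \<and> l x = l y \<and> r x = r y \<and> (x = r x \<or> y = r y)" if xyC: "{x, y} \<in> C" for x y
  proof -
    obtain v where v: "{x, y} = {r v, v}" "v \<in> V" using xyC unfolding C_def by blast
    have "r (r v) = r v" using r[OF v(2)] by (intro r_cong) simp
    then show ?thesis using v r[OF v(2)] by (auto simp: doubleton_eq_iff)
  qed
  have "\<not> is_cycle C p" for p
  proof
    assume cyc: "is_cycle C p"
    then obtain a b c q where p: "p = a # b # c # q"
      unfolding is_cycle_def by (cases p rule: remdups_adj.cases; cases "tl (tl p)") auto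
    \<comment> \<open>No vertex lies on all three of these edges, but a common representative would.\<close>
    have e: "{a, b} \<in> C" "{b, c} \<in> C" "{last p, a} \<in> C"
      and d: "a \<noteq> b" "b \<noteq> c" "a \<noteq> c" "last p \<noteq> b" "last p \<noteq> a"
      using cyc last_in_set[of "c # q"] by (auto simp: p is_cycle_def is_path_def split: if_splits)
    show False using edge[OF e(1)] edge[OF e(2)] edge[OF e(3)] d by metis
  qed
  moreover have "e \<subseteq> V \<and> card e = 2" if "e \<in> C" for e
    using that r by (auto simp: C_def)
  ultimately have "C \<in> constraint_graphs V" by (auto simp: constraint_graphs_def)
  moreover have "linked C u v \<longleftrightarrow> l u = l v" if "u \<in> V" "v \<in> V" for u v
  proof
    show "linked C u v \<Longrightarrow> l u = l v" using linked_invariant[of C l] edge by blast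
    have to_r: "linked C (r w) w" if "w \<in> V" for w
    proof (cases "r w = w")
      case True
      then show ?thesis using linked_refl by metis
    next
      case False
      then show ?thesis using that by (intro linked_edge) (auto simp: C_def)
    qed
    assume "l u = l v"
    then have "r u = r v" by (rule r_cong)
    then show "linked C u v"
      using to_r[OF that(1)] to_r[OF that(2)] linked_sym linked_trans by metis
  qed
  ultimately show ?thesis by blast
qed

section \<open>The multigraph as a strip of layers\<close>

text \<open>
  The vertex of row \<open>j\<close> at time \<open>t\<close>. Indices of vertices start at \<open>1\<close>, times at \<open>0\<close>.
\<close>

definition strip_vertex :: "nat \<Rightarrow> bool \<Rightarrow> nat \<Rightarrow> vertex" where
  "strip_vertex k j t = (let i = t mod (2 * k) div 2 + 1; r = if j then 1 else 2 in
     if even t then VA i r else VB i r)"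

lemma strip_vertex_periodic: "strip_vertex k j (t + 2 * k) = strip_vertex k j t"
  by (simp add: strip_vertex_def)

lemma strip_vertex_even: "i < k \<Longrightarrow> strip_vertex k j (2 * i) = VA (Suc i) (if j then 1 else 2)"
  by (simp add: strip_vertex_def)

lemma strip_vertex_odd: "i < k \<Longrightarrow> strip_vertex k j (Suc (2 * i)) = VB (Suc i) (if j then 1 else 2)"
  by (simp add: strip_vertex_def)

lemma strip_vertex_next:
  assumes "i < k"
  shows "strip_vertex k j (Suc (Suc (2 * i))) = VA (next_idx k (Suc i)) (if j then 1 else 2)"
proof (cases "Suc i = k")
  case True
  then have "Suc (Suc (2 * i)) = 2 * 0 + 2 * k" by simp
  then have "strip_vertex k j (Suc (Suc (2 * i))) = strip_vertex k j (2 * 0)"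
    by (simp only: strip_vertex_periodic)
  then show ?thesis using assms strip_vertex_even[of 0 k j] True by (simp add: next_idx_def)
next
  case False
  then have "Suc i < k" using assms by simp
  then show ?thesis using strip_vertex_even[of "Suc i" k j] False by (simp add: next_idx_def)
qed

lemmas strip_vertex_simps = strip_vertex_even strip_vertex_odd strip_vertex_next

lemma time_cases:
  assumes "t < 2 * k"
  obtains i where "i < k" "t = 2 * i" | i where "i < k" "t = Suc (2 * i)"
  using assms by (cases "even t") (auto elim!: evenE oddE)

lemma H_verts_strip: "H_verts k = (\<Union>t<2 * k. range (\<lambda>j. strip_vertex k j t))"
proof (intro equalityI subsetI)
  fix v assume "v \<in> H_verts k"
  then obtain i j where i: "i < k" and v: "v = VA (Suc i) (if j then 1 else 2) \<or> v = VB (Suc i) (if j then 1 else 2)"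
  proof -
    assume *: "\<And>i j. i < k \<Longrightarrow> v = VA (Suc i) (if j then 1 else 2) \<or> v = VB (Suc i) (if j then 1 else 2) \<Longrightarrow> thesis"
    obtain i r where "i \<in> {1..k}" "r \<in> {1, 2}" "v = VA i r \<or> v = VB i r"
      using \<open>v \<in> H_verts k\<close> by (auto simp: H_verts_def)
    then show thesis using *[of "i - 1" "r = 1"] by auto
  qed
  from v have "v = strip_vertex k j (2 * i) \<or> v = strip_vertex k j (Suc (2 * i))"
    using i by (simp add: strip_vertex_simps)
  moreover have "2 * i \<in> {..<2 * k}" "Suc (2 * i) \<in> {..<2 * k}" using i by auto
  ultimately show "v \<in> (\<Union>t<2 * k. range (\<lambda>j. strip_vertex k j t))" by blast
next
  fix v assume "v \<in> (\<Union>t<2 * k. range (\<lambda>j. strip_vertex k j t))"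
  then obtain t j where "t < 2 * k" "v = strip_vertex k j t" by auto
  then show "v \<in> H_verts k"
    by (elim time_cases) (auto simp: strip_vertex_simps H_verts_def)
qed

lemma strip_vertex_mod: "strip_vertex k j (t mod (2 * k)) = strip_vertex k j t"
  by (simp add: strip_vertex_def dvd_mod_iff)

lemma strip_vertex_in: "0 < k \<Longrightarrow> strip_vertex k j t \<in> H_verts k"
proof -
  assume "0 < k"
  then have "t mod (2 * k) \<in> {..<2 * k}" by simp
  then show ?thesis unfolding H_verts_strip using strip_vertex_mod[of k j t] by (metis UN_I rangeI)
qed

lemma finite_H_verts: "finite (H_verts k)"
  by (simp add: H_verts_strip)

lemma card_H_verts: "card (H_verts k) = 4 * k"
proof -
  have "H_verts k = (\<lambda>(i, j). VA i j) ` ({1..k} \<times> {1, 2}) \<union> (\<lambda>(i, j). VB i j) ` ({1..k} \<times> {1, 2})"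
    by (auto simp: H_verts_def)
  also have "card \<dots> = card ((\<lambda>(i, j). VA i j) ` ({1..k} \<times> {1 :: nat, 2})) + card ((\<lambda>(i, j). VB i j) ` ({1..k} \<times> {1 :: nat, 2}))"
    by (rule card_Un_disjoint) auto
  also have "\<dots> = 4 * k"
    by (subst (1 2) card_image) (auto simp: inj_on_def card_cartesian_product)
  finally show ?thesis .
qed

definition strip_piece :: "nat \<Rightarrow> nat \<Rightarrow> vertex set" where
  "strip_piece k t = range (\<lambda>j. strip_vertex k j t) \<union> range (\<lambda>j. strip_vertex k j (Suc t))"

lemma pieces_strip: "pieces k = strip_piece k ` {..<2 * k}"
proof -
  have even: "strip_piece k (2 * i) = {VA (Suc i) 1, VA (Suc i) 2, VB (Suc i) 1, VB (Suc i) 2}"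
    and odd: "strip_piece k (Suc (2 * i)) = {VB (Suc i) 1, VB (Suc i) 2, VA (next_idx k (Suc i)) 1, VA (next_idx k (Suc i)) 2}"
    if "i < k" for i
    using that unfolding strip_piece_def UNIV_bool by (auto simp: strip_vertex_simps)
  show ?thesis
  proof (intro equalityI subsetI)
    fix P assume "P \<in> pieces k"
    then obtain i where i: "i \<in> {1..k}" "P = {VA i 1, VA i 2, VB i 1, VB i 2} \<or>
        P = {VB i 1, VB i 2, VA (next_idx k i) 1, VA (next_idx k i) 2}"
      by (auto simp: pieces_def)
    define m where "m = i - 1"
    have m: "i = Suc m" "m < k" using i(1) by (auto simp: m_def)
    have "P = strip_piece k (2 * m) \<or> P = strip_piece k (Suc (2 * m))"
      using i(2) even[OF m(2)] odd[OF m(2)] by (simp only: m(1))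
    moreover have "2 * m \<in> {..<2 * k}" "Suc (2 * m) \<in> {..<2 * k}" using m(2) by auto
    ultimately show "P \<in> strip_piece k ` {..<2 * k}" by blast
  next
    fix P assume "P \<in> strip_piece k ` {..<2 * k}"
    then obtain t where t: "t < 2 * k" "P = strip_piece k t" by auto
    from t(1) show "P \<in> pieces k"
    proof (cases rule: time_cases)
      case (1 i)
      have "Suc i \<in> {1..k}" using 1(1) by simp
      then show ?thesis unfolding t(2) 1(2) even[OF 1(1)] pieces_def by blast
    next
      case (2 i)
      have "Suc i \<in> {1..k}" using 2(1) by simp
      then show ?thesis unfolding t(2) 2(2) odd[OF 2(1)] pieces_def by blast
    qed
  qed
qed

lemma image_H_edges:
  "image_mset (image cl) (H_edges k) = (\<Sum>t<2 * k. step_edges (\<lambda>j t. cl (strip_vertex k j t)) t)"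
proof -
  have "image_mset (image cl) (H_edges k) = (\<Sum>i<k. image_mset (image cl)
     {# {VA (Suc i) 1, VB (Suc i) 1}, {VB (Suc i) 1, VA (next_idx k (Suc i)) 1},
        {VA (Suc i) 2, VB (Suc i) 2}, {VB (Suc i) 2, VA (next_idx k (Suc i)) 2},
        {VA (Suc i) 2, VB (Suc i) 1}, {VB (Suc i) 1, VA (next_idx k (Suc i)) 2} #})"
    unfolding H_edges_def One_nat_def sum.atLeast1_atMost_eq by (rule image_mset_sum_lessThan)
  also have "\<dots> = (\<Sum>i<k. step_edges (\<lambda>j t. cl (strip_vertex k j t)) (2 * i) +
      step_edges (\<lambda>j t. cl (strip_vertex k j t)) (2 * i + 1))"
    by (intro sum.cong refl)
      (simp add: step_edges_def walk_edge_def diag_edge_def strip_vertex_simps insert_commute add_mset_commute)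
  also have "\<dots> = (\<Sum>t<2 * k. step_edges (\<lambda>j t. cl (strip_vertex k j t)) t)"
    by (rule sum_double[symmetric])
  finally show ?thesis .
qed

lemma val_nonzero_iff: "val k C \<noteq> 0 \<longleftrightarrow> (\<forall>e. even (count (quotient_edges k C) e))"
  unfolding val_def by (auto simp: not_in_iff)

definition class_walk :: "nat \<Rightarrow> vertex set set \<Rightarrow> bool \<Rightarrow> nat \<Rightarrow> vertex set" where
  "class_walk k C j t = vertex_class k C (strip_vertex k j t)"

lemma class_walk_eq_iff:
  assumes "0 < k"
  shows "class_walk k C i s = class_walk k C j t \<longleftrightarrow> linked C (strip_vertex k i s) (strip_vertex k j t)"
  unfolding class_walk_def vertex_class_def using component_eq_iff[OF strip_vertex_in[OF assms]] .

lemma double_walk_class_walk: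
  assumes k: "0 < k" and C: "C \<in> admissible k" and val: "val k C \<noteq> 0"
  shows "double_walk k (class_walk k C)"
proof
  have per: "strip_piece k (t mod (2 * k)) = strip_piece k t" for t
    unfolding strip_piece_def using strip_vertex_mod[of k _ t]
      strip_vertex_mod[of k _ "Suc t"] strip_vertex_mod[of k _ "Suc (t mod (2 * k))"]
    by (simp add: mod_Suc_eq)
  have sep: "\<not> linked C u v" if "u \<in> strip_piece k t" "v \<in> strip_piece k t" "u \<noteq> v" for u v t
  proof -
    have "strip_piece k t \<in> pieces k"
      unfolding pieces_strip per[of t, symmetric] using k by simp
    then show ?thesis using C that unfolding admissible_def by blast
  qed
  fix i j t
  show "class_walk k C j (t + 2 * k) = class_walk k C j t"
    by (simp add: class_walk_def strip_vertex_periodic)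
  show "class_walk k C True t \<noteq> class_walk k C False t"
    unfolding class_walk_eq_iff[OF k]
    by (rule sep[of _ t]) (auto simp: strip_piece_def strip_vertex_def Let_def)
  show "class_walk k C i t \<noteq> class_walk k C j (Suc t)"
    unfolding class_walk_eq_iff[OF k]
    by (rule sep[of _ t]) (auto simp: strip_piece_def strip_vertex_def Let_def)
next
  fix e
  have "quotient_edges k C = (\<Sum>t<2 * k. step_edges (class_walk k C) t)"
    unfolding quotient_edges_def image_H_edges class_walk_def ..
  then show "even (\<Sum>t<2 * k. count (step_edges (class_walk k C) t) e)"
    using val unfolding val_nonzero_iff by (simp add: count_sum_lessThan)
qed (rule k)

lemma components_class_walk:
  "components (H_verts k) C = (\<Union>t<2 * k. range (\<lambda>j. class_walk k C j t))"
proof -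
  have "components (H_verts k) C = vertex_class k C ` H_verts k"
    by (simp add: components_def vertex_class_def)
  then show ?thesis by (auto simp: H_verts_strip class_walk_def)
qed

lemma card_classes_class_walk:
  assumes k: "0 < k" and C: "C \<in> admissible k" and val: "val k C \<noteq> 0"
  shows "card C + card (double_walk.classes k (class_walk k C)) = 4 * k"
proof -
  interpret double_walk k "class_walk k C" using assms by (rule double_walk_class_walk)
  have "components (H_verts k) C = classes"
    unfolding components_class_walk classes_def layer_def ..
  then show ?thesis
    using card_forest[OF finite_H_verts, of C k] C by (simp add: card_H_verts admissible_def)
qed

lemma card_constraint_graph_ge:
  assumes k: "0 < k" and C: "C \<in> admissible k" and val: "val k C \<noteq> 0"
  shows "2 * k \<le> card C + 2"
proof -
  interpret double_walk k "class_walk k C" using assms by (rule double_walk_class_walk)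
  show ?thesis using card_classes_class_walk[OF assms] card_classes_le by simp
qed

text \<open>
  The labels of \<^const>\<open>interval_walk\<close>, read as a function on the vertices.
\<close>

definition interval_label ::
  "nat \<Rightarrow> (nat \<Rightarrow> nat) \<times> (nat \<Rightarrow> nat) \<Rightarrow> vertex \<Rightarrow> bool \<times> (nat + (nat \<times> nat) set)" where
  "interval_label k fg v = (case v of
      VA i r \<Rightarrow> (r = 1, Inl ((if r = 1 then fst fg else snd fg) (i - 1)))
    | VB i r \<Rightarrow> (r = 1, Inr (separated_pairs k (if r = 1 then fst fg else snd fg) (i - 1))))"

lemma interval_label_strip: "interval_label k (f, g) (strip_vertex k j t) = interval_walk k f g j t"
  by (simp add: interval_label_def strip_vertex_def interval_walk_def row_label_def Let_def)

definition realizes :: "nat \<Rightarrow> vertex set set \<Rightarrow> (nat \<Rightarrow> nat) \<times> (nat \<Rightarrow> nat) \<Rightarrow> bool" where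
  "realizes k C fg \<longleftrightarrow> C \<in> constraint_graphs (H_verts k) \<and>
     (\<forall>u\<in>H_verts k. \<forall>v\<in>H_verts k. linked C u v \<longleftrightarrow> interval_label k fg u = interval_label k fg v)"

lemma realizes_exists: "\<exists>C. realizes k C fg"
  unfolding realizes_def using forest_with_given_classes[of "H_verts k" "interval_label k fg"] by blast

lemma realizes_interval:
  assumes k: "0 < k" and fg: "(f, g) \<in> nc_intervals 0 k" and C: "realizes k C (f, g)"
  shows "C \<in> admissible k" "val k C \<noteq> 0" "card C + 2 = 2 * k"
proof -
  have link: "linked C (strip_vertex k i s) (strip_vertex k j t) \<longleftrightarrow> interval_walk k f g i s = interval_walk k f g j t" for i j s t
    using C strip_vertex_in[OF k] by (simp add: realizes_def interval_label_strip)
  have CG: "C \<in> constraint_graphs (H_verts k)" using C by (simp add: realizes_def)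
  have "\<not> linked C u v" if P: "P \<in> pieces k" and uv: "u \<in> P" "v \<in> P" "u \<noteq> v" for P u v
  proof -
    obtain t where t: "P = strip_piece k t" using P by (auto simp: pieces_strip)
    obtain i s where u: "u = strip_vertex k i s" "s = t \<or> s = Suc t" using uv(1) t by (auto simp: strip_piece_def)
    obtain j s' where v: "v = strip_vertex k j s'" "s' = t \<or> s' = Suc t" using uv(2) t by (auto simp: strip_piece_def)
    have "i \<noteq> j \<or> even s \<noteq> even s'" using u v uv(3) by (cases "i = j") auto
    then show ?thesis unfolding u(1) v(1) link
      by (auto simp: interval_walk_def row_label_def Let_def)
  qed
  then show adm: "C \<in> admissible k" using CG by (auto simp: admissible_def)
  define fib where "fib l = {v \<in> H_verts k. interval_label k (f, g) v = l}" for l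
  have walk: "class_walk k C j t = fib (interval_walk k f g j t)" for j t
    using C strip_vertex_in[OF k, of j t]
    by (auto simp: class_walk_def vertex_class_def fib_def realizes_def interval_label_strip)
  obtain N where N: "(\<Sum>t<2 * k. step_edges (interval_walk k f g) t) = N + N"
    using interval_walk_even_edges[OF fg k] by blast
  have "step_edges (class_walk k C) t = image_mset (image fib) (step_edges (interval_walk k f g) t)" for t
    by (simp add: step_edges_def walk_edge_def diag_edge_def walk)
  then have "quotient_edges k C = image_mset (image fib) (N + N)"
    unfolding N[symmetric] image_mset_sum_lessThan quotient_edges_def image_H_edges class_walk_def[symmetric] by simp
  then show val: "val k C \<noteq> 0" unfolding val_nonzero_iff by simp
  interpret double_walk k "class_walk k C" using k adm val by (rule double_walk_class_walk)
  have "interval_walk k f g i s = interval_walk k f g j t"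
    if "class_walk k C i s = class_walk k C j t" for i j s t
    using that unfolding class_walk_eq_iff[OF k] link .
  then have "inj_on fib (\<Union>t<2 * k. range (\<lambda>j. interval_walk k f g j t))"
    unfolding inj_on_def walk by blast
  moreover have "classes = fib ` (\<Union>t<2 * k. range (\<lambda>j. interval_walk k f g j t))"
  proof -
    have "classes = (\<Union>t<2 * k. range (\<lambda>j. class_walk k C j t))"
      unfolding classes_def layer_def ..
    then show ?thesis by (simp only: walk image_UN image_image)
  qed
  ultimately have "card classes = card (\<Union>t<2 * k. range (\<lambda>j. interval_walk k f g j t))"
    by (simp add: card_image)
  then have "2 * k + 2 \<le> card classes" using card_interval_walk[OF fg k] by simp
  then show "card C + 2 = 2 * k"
    using card_classes_class_walk[OF k adm val] card_constraint_graph_ge[OF k adm val] by simp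
qed

lemma id_interval: "(id, id) \<in> nc_intervals 0 k"
  by (auto simp: nc_intervals_def bracketing_def)

text \<open>
  The minimum \<open>2k - 2\<close> is attained, for instance by the interval that consists of the discrete
  partition alone.
\<close>

lemma dominant_iff:
  assumes k: "0 < k"
  shows "dominant k C \<longleftrightarrow> C \<in> admissible k \<and> val k C \<noteq> 0 \<and> card C + 2 = 2 * k"
proof -
  obtain C0 where "realizes k C0 (id, id)" using realizes_exists by blast
  from realizes_interval[OF k id_interval this]
  have C0: "C0 \<in> admissible k" "val k C0 \<noteq> 0" "card C0 + 2 = 2 * k" by auto
  show ?thesis
    using card_constraint_graph_ge[OF k] C0 unfolding dominant_def by fastforce
qed

text \<open>
  A dominant constraint graph has \<open>2k + 2\<close> classes, so its walk is extremal, and its classes are named by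
  the labels of the interval read off from that walk.
\<close>

lemma dominant_realizes:
  assumes k: "0 < k" and C: "dominant k C"
  shows "\<exists>fg \<in> nc_intervals 0 k. realizes k C fg"
proof -
  have adm: "C \<in> admissible k" and val: "val k C \<noteq> 0" and card: "card C + 2 = 2 * k"
    using C unfolding dominant_iff[OF k] by blast+
  interpret double_walk k "class_walk k C" using k adm val by (rule double_walk_class_walk)
  interpret extremal_walk k "class_walk k C"
    by unfold_locales (use card_classes_class_walk[OF k adm val] card in simp)
  let ?f = "block_last True" and ?g = "block_last False"
  have row: "class_walk k C j s = class_walk k C j t \<longleftrightarrow> row_label k (block_last j) s = row_label k (block_last j) t"
    if "s < 2 * k" "t < 2 * k" for j s t
    using that
    by (elim time_cases)
      (use same_class_same_row[of j s j t] block_last_eq_iff[of _ _ j] gap_class_iff[of _ _ j] in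
        \<open>auto simp: row_label_even row_label_odd[simplified]\<close>)
  have "linked C (strip_vertex k i s) (strip_vertex k j t) \<longleftrightarrow> interval_walk k ?f ?g i s = interval_walk k ?f ?g j t"
    if "s < 2 * k" "t < 2 * k" for i j s t
  proof -
    have "class_walk k C i s = class_walk k C j t \<longleftrightarrow> i = j \<and> class_walk k C j s = class_walk k C j t"
      using same_class_same_row[of i s j t] by auto
    then show ?thesis
      unfolding class_walk_eq_iff[OF k, symmetric] interval_walk_def using row[OF that] by (cases i; cases j) auto
  qed
  then have "realizes k C (?f, ?g)"
    using adm unfolding realizes_def H_verts_strip admissible_def
    by (auto simp: interval_label_strip)
  then show ?thesis using block_last_interval by blast
qed

definition interval_relation :: "nat \<Rightarrow> (nat \<Rightarrow> nat) \<times> (nat \<Rightarrow> nat) \<Rightarrow> (vertex \<times> vertex) set" where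
  "interval_relation k fg =
     {(u, v). u \<in> H_verts k \<and> v \<in> H_verts k \<and> interval_label k fg u = interval_label k fg v}"

definition linked_relation :: "nat \<Rightarrow> vertex set set \<Rightarrow> (vertex \<times> vertex) set" where
  "linked_relation k C = {(u, v). u \<in> H_verts k \<and> v \<in> H_verts k \<and> linked C u v}"

lemma bracketing_eqI:
  assumes f: "bracketing 0 k f" and f': "bracketing 0 k f'"
    and ker: "\<And>i j. i < k \<Longrightarrow> j < k \<Longrightarrow> f i = f j \<longleftrightarrow> f' i = f' j"
  shows "f = f'"
proof
  have le: "f i \<le> f' i" if f: "bracketing 0 k f" and f': "bracketing 0 k f'"
    and ker: "\<And>i j. i < k \<Longrightarrow> j < k \<Longrightarrow> f i = f j \<Longrightarrow> f' i = f' j" and i: "i < k" for f f' i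
    using ker[OF bracketing_less[OF f i] i] bracketing_idem[OF f, of i] bracketing_le[OF f', of "f i"] by simp
  fix i show "f i = f' i"
  proof (cases "i < k")
    case True
    show ?thesis using le[OF f f' _ True] le[OF f' f _ True] ker by (intro antisym) blast+
  next
    case False
    then show ?thesis using bracketing_outside[OF f, of i] bracketing_outside[OF f', of i] by simp
  qed
qed

text \<open>
  The partitions are recovered from the relation on the \<open>a\<close>-vertices: a block function is determined by
  which points have equal values, its value being the last point of the block.
\<close>

lemma inj_interval_relation: "inj_on (interval_relation k) (nc_intervals 0 k)"
proof (rule inj_onI, clarify)
  fix f g f' g' assume fg: "(f, g) \<in> nc_intervals 0 k" "(f', g') \<in> nc_intervals 0 k"
    and eq: "interval_relation k (f, g) = interval_relation k (f', g')"
  have ker: "(if r then f else g) i = (if r then f else g) j \<longleftrightarrow> (if r then f' else g') i = (if r then f' else g') j"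
    if "i < k" "j < k" for i j r
  proof -
    let ?u = "strip_vertex k r (2 * i)" and ?v = "strip_vertex k r (2 * j)"
    have "0 < k" using that by simp
    then have "(?u, ?v) \<in> interval_relation k (f, g) \<longleftrightarrow> interval_walk k f g r (2 * i) = interval_walk k f g r (2 * j)"
      "(?u, ?v) \<in> interval_relation k (f', g') \<longleftrightarrow> interval_walk k f' g' r (2 * i) = interval_walk k f' g' r (2 * j)"
      by (simp_all add: interval_relation_def strip_vertex_in interval_label_strip)
    then show ?thesis using eq that by (simp add: interval_walk_def row_label_even)
  qed
  show "f = f' \<and> g = g'"
    using fg bracketing_eqI[of k f f'] bracketing_eqI[of k g g'] ker[of _ _ True] ker[of _ _ False]
    by (simp add: nc_intervals_def)
qed

lemma realizes_linked_relation: "realizes k C fg \<Longrightarrow> linked_relation k C = interval_relation k fg"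
  by (auto simp: realizes_def linked_relation_def interval_relation_def)

lemma linked_relations_of_dominant:
  assumes k: "0 < k"
  shows "linked_relation k ` {C \<in> admissible k. dominant k C} = interval_relation k ` nc_intervals 0 k"
proof (intro equalityI subsetI)
  fix R assume "R \<in> linked_relation k ` {C \<in> admissible k. dominant k C}"
  then obtain C where C: "R = linked_relation k C" "dominant k C" by auto
  then obtain fg where "fg \<in> nc_intervals 0 k" "realizes k C fg" using dominant_realizes[OF k] by blast
  then show "R \<in> interval_relation k ` nc_intervals 0 k"
    using C realizes_linked_relation by blast
next
  fix R assume "R \<in> interval_relation k ` nc_intervals 0 k"
  then obtain f g where fg: "(f, g) \<in> nc_intervals 0 k" "R = interval_relation k (f, g)" by auto
  obtain C where C: "realizes k C (f, g)" using realizes_exists by blast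
  then have "C \<in> admissible k" "dominant k C"
    using realizes_interval[OF k fg(1) C] dominant_iff[OF k] by auto
  then show "R \<in> linked_relation k ` {C \<in> admissible k. dominant k C}"
    using realizes_linked_relation[OF C] fg(2) by blast
qed

lemma card_image_cong_kernel:
  assumes "\<And>x y. x \<in> A \<Longrightarrow> y \<in> A \<Longrightarrow> p x = p y \<longleftrightarrow> q x = q y"
  shows "card (p ` A) = card (q ` A)"
proof -
  have "q (inv_into A p (p x)) = q x" if "x \<in> A" for x
    using assms[of "inv_into A p (p x)" x] that by (simp add: inv_into_into f_inv_into_f)
  then have img: "(\<lambda>z. q (inv_into A p z)) ` p ` A = q ` A" by (force simp: image_image)
  have "inj_on (\<lambda>z. q (inv_into A p z)) (p ` A)"
    using assms by (auto simp: inj_on_def inv_into_into f_inv_into_f) (metis f_inv_into_f inv_into_into imageI)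
  then show ?thesis using card_image img by metis
qed

lemma card_dominant_classes:
  "card (dominant_classes k) = card (linked_relation k ` {C \<in> admissible k. dominant k C})"
proof -
  let ?r = "constraint_equiv (H_verts k)" and ?D = "{C \<in> admissible k. dominant k C}"
  have "dominant_classes k = (\<lambda>C. ?r `` {C}) ` ?D"
    unfolding dominant_classes_def quotient_def by auto
  also have "card \<dots> = card (linked_relation k ` ?D)"
  proof (rule card_image_cong_kernel)
    fix C C' assume "C \<in> ?D" "C' \<in> ?D"
    then have CG: "C \<in> constraint_graphs (H_verts k)" "C' \<in> constraint_graphs (H_verts k)"
      by (auto simp: admissible_def)
    have "?r `` {C} = ?r `` {C'} \<longleftrightarrow> (C, C') \<in> ?r"
      using eq_equiv_class_iff[OF equiv_constraint_equiv CG] .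
    also have "\<dots> \<longleftrightarrow> linked_relation k C = linked_relation k C'"
      using CG by (auto simp: constraint_equiv_def linked_relation_def set_eq_iff)
    finally show "?r `` {C} = ?r `` {C'} \<longleftrightarrow> linked_relation k C = linked_relation k C'" .
  qed
  finally show ?thesis .
qed

theorem theorem3p1:
  fixes k :: nat
  assumes "k \<ge> 1"
  shows "real (card (dominant_classes k)) = 1 / (2 * real k + 1) * real ((3 * k) choose k)"
proof -
  have k: "0 < k" using assms by simp
  have "card (dominant_classes k) = card (interval_relation k ` nc_intervals 0 k)"
    unfolding card_dominant_classes linked_relations_of_dominant[OF k] ..
  also have "\<dots> = card (nc_intervals 0 k)"
    by (rule card_image[OF inj_interval_relation])
  finally show ?thesis by (simp only: card_nc_intervals_closed)
qed

end
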